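(* Any tester for determining whether a bipartite pure state in $\mathbb{C}^d\otimes\mathbb{C}^d$ is maximally entangled or $\varepsilon$-far from every maximally entangled state (in trace distance) requires sample complexity $\mathsf{S}(\textsc{MaximalEntanglement}_\varepsilon)=\Omega(d/\varepsilon^2)$.
   Context: $\textsc{MaximalEntanglement}$ is the set of unit vectors $|\psi\rangle\in\mathbb{C}^d\otimes\mathbb{C}^d$ with $\mathrm{tr}_B|\psi\rangle\langle\psi|=I/d$. For a set $\mathcal{Q}$ of pure states, $\mathcal{Q}_\varepsilon$ has yes-set $\mathcal{Q}$ and no-set the pure states at trace distance $\ge\varepsilon$ from all of $\mathcal{Q}$ (trace distance of pure states $\sqrt{1-|\langle\psi|\phi\rangle|^2}$). $\mathsf{S}(\cdot)$ is the minimum $N$ such that some operator $0\preceq\mathcal{T}\preceq I$ on $N$ copies accepts yes-instances with probability $\ge2/3$ and no-instances with probability $\le1/3$. *)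

theory Defs
  imports "HOL-Analysis.Analysis" "HOL-Library.Extended_Real"
begin

text \<open>Basis indices of C^d (x) C^d are pairs (i,j) with i,j < d.
  A vector of C^d (x) C^d is a function nat*nat => complex (only values on the box matter).\<close>

definition box :: "nat \<Rightarrow> (nat \<times> nat) set" where
  "box d = {0..<d} \<times> {0..<d}"

text \<open>Basis indices of the N-copy space (C^d (x) C^d)^(x)N: lists of N pairs.\<close>
definition copy_idx :: "nat \<Rightarrow> nat \<Rightarrow> (nat \<times> nat) list set" where
  "copy_idx d N = {xs. length xs = N \<and> set xs \<subseteq> box d}"

definition unit_state :: "nat \<Rightarrow> (nat \<times> nat \<Rightarrow> complex) \<Rightarrow> bool" where
  "unit_state d \<psi> \<longleftrightarrow> (\<Sum>p\<in>box d. (cmod (\<psi> p))\<^sup>2) = 1"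

definition partial_trace_B :: "nat \<Rightarrow> (nat \<times> nat \<Rightarrow> complex) \<Rightarrow> nat \<Rightarrow> nat \<Rightarrow> complex" where
  "partial_trace_B d \<psi> i k = (\<Sum>j<d. \<psi> (i, j) * cnj (\<psi> (k, j)))"

definition maximally_entangled :: "nat \<Rightarrow> (nat \<times> nat \<Rightarrow> complex) \<Rightarrow> bool" where
  "maximally_entangled d \<psi> \<longleftrightarrow> unit_state d \<psi> \<and>
     (\<forall>i<d. \<forall>k<d. partial_trace_B d \<psi> i k = (if i = k then 1 / of_nat d else 0))"

definition pure_trace_dist :: "nat \<Rightarrow> (nat \<times> nat \<Rightarrow> complex) \<Rightarrow> (nat \<times> nat \<Rightarrow> complex) \<Rightarrow> real" where
  "pure_trace_dist d \<psi> \<phi> = sqrt (1 - (cmod (\<Sum>p\<in>box d. cnj (\<psi> p) * \<phi> p))\<^sup>2)"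

definition far_from_ME :: "nat \<Rightarrow> real \<Rightarrow> (nat \<times> nat \<Rightarrow> complex) \<Rightarrow> bool" where
  "far_from_ME d \<epsilon> \<psi> \<longleftrightarrow> unit_state d \<psi> \<and>
     (\<forall>\<phi>. maximally_entangled d \<phi> \<longrightarrow> pure_trace_dist d \<psi> \<phi> \<ge> \<epsilon>)"

definition tensor_pow :: "(nat \<times> nat \<Rightarrow> complex) \<Rightarrow> (nat \<times> nat) list \<Rightarrow> complex" where
  "tensor_pow \<psi> xs = prod_list (map \<psi> xs)"

definition qform :: "'a set \<Rightarrow> ('a \<Rightarrow> 'a \<Rightarrow> complex) \<Rightarrow> ('a \<Rightarrow> complex) \<Rightarrow> complex" where
  "qform A T v = (\<Sum>x\<in>A. cnj (v x) * (\<Sum>y\<in>A. T x y * v y))"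

definition psd_on :: "'a set \<Rightarrow> ('a \<Rightarrow> 'a \<Rightarrow> complex) \<Rightarrow> bool" where
  "psd_on A T \<longleftrightarrow> (\<forall>v. qform A T v \<in> \<real> \<and> 0 \<le> Re (qform A T v))"

definition valid_measurement :: "nat \<Rightarrow> nat \<Rightarrow> ((nat \<times> nat) list \<Rightarrow> (nat \<times> nat) list \<Rightarrow> complex) \<Rightarrow> bool" where
  "valid_measurement d N T \<longleftrightarrow> psd_on (copy_idx d N) T \<and>
     psd_on (copy_idx d N) (\<lambda>x y. (if x = y then 1 else 0) - T x y)"

definition accept_prob :: "nat \<Rightarrow> nat \<Rightarrow> ((nat \<times> nat) list \<Rightarrow> (nat \<times> nat) list \<Rightarrow> complex) \<Rightarrow> (nat \<times> nat \<Rightarrow> complex) \<Rightarrow> real" where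
  "accept_prob d N T \<psi> = Re (qform (copy_idx d N) T (tensor_pow \<psi>))"

definition is_ME_tester :: "nat \<Rightarrow> real \<Rightarrow> nat \<Rightarrow> ((nat \<times> nat) list \<Rightarrow> (nat \<times> nat) list \<Rightarrow> complex) \<Rightarrow> bool" where
  "is_ME_tester d \<epsilon> N T \<longleftrightarrow> valid_measurement d N T \<and>
     (\<forall>\<psi>. maximally_entangled d \<psi> \<longrightarrow> accept_prob d N T \<psi> \<ge> 2/3) \<and>
     (\<forall>\<psi>. far_from_ME d \<epsilon> \<psi> \<longrightarrow> accept_prob d N T \<psi> \<le> 1/3)"

text \<open>S(MaximalEntanglement_eps): minimum number of copies; infinity if no tester exists.\<close>
definition sample_complexity_ME :: "nat \<Rightarrow> real \<Rightarrow> enat" where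
  "sample_complexity_ME d \<epsilon> = Inf {enat N | N. \<exists>T. is_ME_tester d \<epsilon> N T}"

end

theory Submission
  imports Defs "HOL-Computational_Algebra.Polynomial"
begin

text \<open>Let \<open>\<Omega>\<close> be the canonical maximally entangled state and \<open>Z\<close> a random Hermitian involution
  acting on the first factor. The state proportional to \<open>(1 + t Z) \<Omega>\<close> with \<open>t = 2 \<epsilon>\<close> is \<open>\<epsilon>\<close>-far
  from every maximally entangled state. One may assume that the tester commutes with \<open>U\<^sup>\<otimes>\<^sup>N\<close> for all
  local unitaries \<open>U\<close>; then it also commutes with \<open>(1 + t Z)\<^sup>\<otimes>\<^sup>N\<close>, so that the acceptance
  probability is linear in \<open>P\<^sup>\<otimes>\<^sup>N \<Omega>\<^sup>\<otimes>\<^sup>N\<close>, where \<open>P\<close> is \<open>(1 + t Z)\<^sup>2\<close> normalised. By Cauchy--Schwarz the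
  bias is controlled by the average of \<open>\<langle>P \<Omega>, P' \<Omega>\<rangle>\<^sup>N\<close> over independent \<open>Z, Z'\<close>, which is essentially
  that of \<open>exp (4 t\<^sup>2 (N / d) tr (Z Z'))\<close>. For a suitable ensemble \<open>tr (Z Z')\<close> has fluctuations of
  constant order with exponential tails, so this is close to 1 unless \<open>N\<close> is of order \<open>d / \<epsilon>\<^sup>2\<close>.\<close>

section \<open>Sesquilinear forms and unitaries on finite index sets\<close>

definition cinner :: "'a set \<Rightarrow> ('a \<Rightarrow> complex) \<Rightarrow> ('a \<Rightarrow> complex) \<Rightarrow> complex" where
  "cinner A v w = (\<Sum>x\<in>A. cnj (v x) * w x)"

definition sqnorm :: "'a set \<Rightarrow> ('a \<Rightarrow> complex) \<Rightarrow> real" where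
  "sqnorm A v = (\<Sum>x\<in>A. (cmod (v x))\<^sup>2)"

definition mat_vec :: "'a set \<Rightarrow> ('a \<Rightarrow> 'a \<Rightarrow> complex) \<Rightarrow> ('a \<Rightarrow> complex) \<Rightarrow> 'a \<Rightarrow> complex" where
  "mat_vec A T v x = (\<Sum>y\<in>A. T x y * v y)"

text \<open>The polarised version of \<open>qform\<close>: the argument moves local operators from
  one slot to the other, so both slots must be free.\<close>

definition sform :: "'a set \<Rightarrow> ('a \<Rightarrow> 'a \<Rightarrow> complex) \<Rightarrow> ('a \<Rightarrow> complex) \<Rightarrow> ('a \<Rightarrow> complex) \<Rightarrow> complex" where
  "sform A T v w = (\<Sum>x\<in>A. \<Sum>y\<in>A. cnj (v x) * T x y * w y)"

definition frob :: "'a set \<Rightarrow> ('a \<Rightarrow> 'a \<Rightarrow> complex) \<Rightarrow> real" where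
  "frob A T = (\<Sum>x\<in>A. \<Sum>y\<in>A. (cmod (T x y))\<^sup>2)"

text \<open>Orthonormality of rows and of columns is built in together, which makes the notion
  closed under adjoint and transpose at once.\<close>

definition unitary_on :: "'a set \<Rightarrow> ('a \<Rightarrow> 'a \<Rightarrow> complex) \<Rightarrow> bool" where
  "unitary_on A u \<longleftrightarrow>
     (\<forall>x\<in>A. \<forall>y\<in>A. (\<Sum>z\<in>A. u x z * cnj (u y z)) = (if x = y then 1 else 0)) \<and>
     (\<forall>x\<in>A. \<forall>y\<in>A. (\<Sum>z\<in>A. cnj (u z x) * u z y) = (if x = y then 1 else 0))"

definition dagger :: "('a \<Rightarrow> 'a \<Rightarrow> complex) \<Rightarrow> 'a \<Rightarrow> 'a \<Rightarrow> complex" where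
  "dagger u x y = cnj (u y x)"

definition id_mat :: "'a \<Rightarrow> 'a \<Rightarrow> complex" where
  "id_mat x y = (if x = y then 1 else 0)"

lemma qform_eq_sform: "qform A T v = sform A T v v"
  by (simp add: qform_def sform_def sum_distrib_left mult.assoc)

lemma sform_cong:
  assumes "\<And>x. x \<in> A \<Longrightarrow> v x = v' x" "\<And>x. x \<in> A \<Longrightarrow> w x = w' x"
    and "\<And>x y. x \<in> A \<Longrightarrow> y \<in> A \<Longrightarrow> T x y = T' x y"
  shows "sform A T v w = sform A T' v' w'"
  unfolding sform_def using assms by (intro sum.cong) auto

lemma sform_add_left: "sform A T (\<lambda>x. v x + v' x) w = sform A T v w + sform A T v' w"
  by (simp add: sform_def algebra_simps sum.distrib)

lemma sform_add_right: "sform A T v (\<lambda>x. w x + w' x) = sform A T v w + sform A T v w'"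
  by (simp add: sform_def algebra_simps sum.distrib)

lemma sform_scale_left: "sform A T (\<lambda>x. c * v x) w = cnj c * sform A T v w"
  by (simp add: sform_def algebra_simps sum_distrib_left)

lemma sform_scale_right: "sform A T v (\<lambda>x. c * w x) = c * sform A T v w"
  by (simp add: sform_def algebra_simps sum_distrib_left)

lemma sform_sum_left: "sform A T (\<lambda>x. \<Sum>e\<in>E. v e x) w = (\<Sum>e\<in>E. sform A T (v e) w)"
  by (induction E rule: infinite_finite_induct) (simp_all add: sform_add_left, simp_all add: sform_def)

lemma sform_sum_right: "sform A T v (\<lambda>x. \<Sum>e\<in>E. w e x) = (\<Sum>e\<in>E. sform A T v (w e))"
  by (induction E rule: infinite_finite_induct) (simp_all add: sform_add_right, simp_all add: sform_def)

lemma sform_diff_mat: "sform A (\<lambda>x y. S x y - T x y) v w = sform A S v w - sform A T v w"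
  by (simp add: sform_def algebra_simps sum_subtractf)

lemma sform_id_mat: "finite A \<Longrightarrow> sform A id_mat v w = cinner A v w"
  by (auto simp: sform_def cinner_def id_mat_def if_distrib if_distribR sum.delta sum.delta' cong: if_cong)

lemma cinner_self: "cinner A v v = of_real (sqnorm A v)"
  by (simp add: cinner_def sqnorm_def complex_norm_square mult.commute del: of_real_power)

lemma sqnorm_eq_cinner: "sqnorm A v = Re (cinner A v v)"
  by (simp add: cinner_self)

lemma sqnorm_nonneg: "0 \<le> sqnorm A v"
  by (simp add: sqnorm_def sum_nonneg)

lemma cinner_cong:
  "(\<And>x. x \<in> A \<Longrightarrow> v x = v' x) \<Longrightarrow> (\<And>x. x \<in> A \<Longrightarrow> w x = w' x) \<Longrightarrow> cinner A v w = cinner A v' w'"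
  unfolding cinner_def by (intro sum.cong) auto

lemma cinner_add_left: "cinner A (\<lambda>x. v x + v' x) w = cinner A v w + cinner A v' w"
  by (simp add: cinner_def algebra_simps sum.distrib)

lemma cinner_add_right: "cinner A v (\<lambda>x. w x + w' x) = cinner A v w + cinner A v w'"
  by (simp add: cinner_def algebra_simps sum.distrib)

lemma cinner_scale_left: "cinner A (\<lambda>x. c * v x) w = cnj c * cinner A v w"
  by (simp add: cinner_def algebra_simps sum_distrib_left)

lemma cinner_scale_right: "cinner A v (\<lambda>x. c * w x) = c * cinner A v w"
  by (simp add: cinner_def algebra_simps sum_distrib_left)

lemma cinner_sum_left: "cinner A (\<lambda>x. \<Sum>e\<in>E. v e x) w = (\<Sum>e\<in>E. cinner A (v e) w)"
  by (induction E rule: infinite_finite_induct) (simp_all add: cinner_add_left, simp_all add: cinner_def)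

lemma cinner_sum_right: "cinner A v (\<lambda>x. \<Sum>e\<in>E. w e x) = (\<Sum>e\<in>E. cinner A v (w e))"
  by (induction E rule: infinite_finite_induct) (simp_all add: cinner_add_right, simp_all add: cinner_def)

lemma cnj_cinner: "cnj (cinner A v w) = cinner A w v"
  by (simp add: cinner_def mult.commute)

lemma cmod_cinner_le: "cmod (cinner A v w) \<le> sqrt (sqnorm A v) * sqrt (sqnorm A w)"
proof -
  have "cmod (cinner A v w) \<le> (\<Sum>x\<in>A. cmod (v x) * cmod (w x))"
    unfolding cinner_def by (rule order_trans[OF norm_sum]) (simp add: norm_mult)
  also have "\<dots> \<le> L2_set (\<lambda>x. cmod (v x)) A * L2_set (\<lambda>x. cmod (w x)) A"
    using L2_set_mult_ineq[of "\<lambda>x. cmod (v x)" "\<lambda>x. cmod (w x)" A] by simp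
  finally show ?thesis by (simp add: L2_set_def sqnorm_def)
qed

lemma unitary_on_dagger: "unitary_on A u \<Longrightarrow> unitary_on A (dagger u)"
  by (auto simp: unitary_on_def dagger_def)

lemma cinner_unitary:
  assumes "finite A" "unitary_on A u"
  shows "cinner A (mat_vec A u v) (mat_vec A u w) = cinner A v w"
proof -
  have "cinner A (mat_vec A u v) (mat_vec A u w)
      = (\<Sum>z\<in>A. \<Sum>x\<in>A. \<Sum>y\<in>A. cnj (v x) * w y * (cnj (u z x) * u z y))"
    unfolding cinner_def mat_vec_def cnj_sum complex_cnj_mult sum_product
    by (intro sum.cong refl) (simp add: algebra_simps)
  also have "\<dots> = (\<Sum>x\<in>A. \<Sum>z\<in>A. \<Sum>y\<in>A. cnj (v x) * w y * (cnj (u z x) * u z y))"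
    by (rule sum.swap)
  also have "\<dots> = (\<Sum>x\<in>A. \<Sum>y\<in>A. \<Sum>z\<in>A. cnj (v x) * w y * (cnj (u z x) * u z y))"
    by (intro sum.cong refl sum.swap)
  also have "\<dots> = (\<Sum>x\<in>A. \<Sum>y\<in>A. cnj (v x) * w y * (if x = y then 1 else 0))"
    using assms(2) by (simp add: sum_distrib_left[symmetric] unitary_on_def)
  also have "\<dots> = cinner A v w"
    using assms(1) by (simp add: cinner_def if_distrib cong: if_cong)
  finally show ?thesis .
qed

lemma sqnorm_unitary:
  "finite A \<Longrightarrow> unitary_on A u \<Longrightarrow> sqnorm A (mat_vec A u v) = sqnorm A v"
  by (simp add: sqnorm_eq_cinner cinner_unitary)

lemma mat_vec_dagger:
  assumes "finite A" "unitary_on A u" "x \<in> A"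
  shows "mat_vec A u (mat_vec A (dagger u) v) x = v x"
proof -
  have "mat_vec A u (mat_vec A (dagger u) v) x = (\<Sum>z\<in>A. \<Sum>y\<in>A. v y * (u x z * cnj (u y z)))"
    by (simp add: mat_vec_def dagger_def sum_distrib_left algebra_simps)
  also have "\<dots> = (\<Sum>y\<in>A. \<Sum>z\<in>A. v y * (u x z * cnj (u y z)))"
    by (rule sum.swap)
  also have "\<dots> = (\<Sum>y\<in>A. v y * (if x = y then 1 else 0))"
    using assms by (simp add: sum_distrib_left[symmetric] unitary_on_def)
  also have "\<dots> = v x"
    using assms by (simp add: if_distrib cong: if_cong)
  finally show ?thesis .
qed

text \<open>The product of the adjoint of \<open>u\<close>, \<open>T\<close> and \<open>u\<close>:
  measuring it amounts to applying \<open>u\<close> first and then measuring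
  \<open>T\<close>.\<close>

definition conj_mat :: "'a set \<Rightarrow> ('a \<Rightarrow> 'a \<Rightarrow> complex) \<Rightarrow> ('a \<Rightarrow> 'a \<Rightarrow> complex) \<Rightarrow> 'a \<Rightarrow> 'a \<Rightarrow> complex" where
  "conj_mat A u T x y = sform A T (\<lambda>a. u a x) (\<lambda>b. u b y)"

lemma sform_conj_mat:
  assumes "finite A"
  shows "sform A (conj_mat A u T) v w = sform A T (mat_vec A u v) (mat_vec A u w)"
proof -
  have "sform A T (mat_vec A u v) (mat_vec A u w)
      = sform A T (\<lambda>a. \<Sum>x\<in>A. v x * u a x) (\<lambda>b. \<Sum>y\<in>A. w y * u b y)"
    by (intro sform_cong) (simp_all add: mat_vec_def mult.commute)
  also have "\<dots> = (\<Sum>x\<in>A. \<Sum>y\<in>A. cnj (v x) * conj_mat A u T x y * w y)"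
    by (simp add: sform_sum_left sform_sum_right sform_scale_left sform_scale_right conj_mat_def
        sum_distrib_left algebra_simps)
  finally show ?thesis by (simp add: sform_def)
qed

lemma unitary_on_transpose: "unitary_on A u \<Longrightarrow> unitary_on A (\<lambda>x y. u y x)"
  unfolding unitary_on_def
  by (auto simp: mult.commute)

text \<open>Right multiplication by \<open>u\<close> acts on each row of \<open>T\<close> by the
  transpose of \<open>u\<close>, left multiplication by the adjoint acts on each column, and both
  preserve Euclidean norms. \<open>R\<close> is the intermediate product \<open>T u\<close>.\<close>

lemma frob_conj_mat:
  assumes "finite A" "unitary_on A u"
  shows "frob A (conj_mat A u T) = frob A T"
proof -
  define R where "R a = mat_vec A (\<lambda>y b. u b y) (T a)" for a
  have conj: "conj_mat A u T x y = mat_vec A (dagger u) (\<lambda>a. R a y) x" for x y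
    by (simp add: conj_mat_def sform_def mat_vec_def dagger_def R_def sum_distrib_left algebra_simps)
  have "frob A (conj_mat A u T) = (\<Sum>y\<in>A. sqnorm A (mat_vec A (dagger u) (\<lambda>a. R a y)))"
    unfolding frob_def sqnorm_def conj by (rule sum.swap)
  also have "\<dots> = (\<Sum>y\<in>A. sqnorm A (\<lambda>a. R a y))"
    using assms by (simp add: sqnorm_unitary unitary_on_dagger)
  also have "\<dots> = (\<Sum>a\<in>A. sqnorm A (R a))"
    unfolding sqnorm_def by (rule sum.swap)
  also have "\<dots> = frob A T"
    using assms by (simp add: R_def sqnorm_unitary unitary_on_transpose) (simp add: frob_def sqnorm_def)
  finally show ?thesis .
qed

section \<open>Tensor powers and local unitaries\<close>

definition tensor_mat :: "('a \<Rightarrow> 'a \<Rightarrow> complex) \<Rightarrow> 'a list \<Rightarrow> 'a list \<Rightarrow> complex" where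
  "tensor_mat u xs ys = prod_list (map2 u xs ys)"

lemma tensor_mat_Nil [simp]: "tensor_mat u [] ys = 1" "tensor_mat u xs [] = 1"
  by (simp_all add: tensor_mat_def)

lemma tensor_mat_Cons [simp]: "tensor_mat u (p # xs) (q # ys) = u p q * tensor_mat u xs ys"
  by (simp add: tensor_mat_def)

lemma tensor_pow_Nil [simp]: "tensor_pow \<psi> [] = 1"
  by (simp add: tensor_pow_def)

lemma tensor_pow_Cons [simp]: "tensor_pow \<psi> (p # xs) = \<psi> p * tensor_pow \<psi> xs"
  by (simp add: tensor_pow_def)

lemma finite_box [simp]: "finite (box d)"
  by (simp add: box_def)

lemma copy_idx_0 [simp]: "copy_idx d 0 = {[]}"
  by (auto simp: copy_idx_def)

lemma copy_idx_Suc: "copy_idx d (Suc N) = (\<lambda>(p, xs). p # xs) ` (box d \<times> copy_idx d N)"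
  by (force simp: copy_idx_def length_Suc_conv)

lemma copy_idx_SucE:
  assumes "xs \<in> copy_idx d (Suc N)"
  obtains p ys where "xs = p # ys" "p \<in> box d" "ys \<in> copy_idx d N"
  using assms unfolding copy_idx_Suc by auto

lemma finite_copy_idx [simp]: "finite (copy_idx d N)"
  by (induction N) (simp_all add: copy_idx_Suc)

lemma sum_copy_idx_Suc:
  "sum f (copy_idx d (Suc N)) = (\<Sum>p\<in>box d. \<Sum>xs\<in>copy_idx d N. f (p # xs))"
proof -
  have "inj_on (\<lambda>(p, xs). p # xs) (box d \<times> copy_idx d N)"
    by (auto intro: inj_onI)
  then show ?thesis
    unfolding copy_idx_Suc by (simp add: sum.reindex sum.cartesian_product case_prod_unfold)
qed

lemma cinner_tensor_pow:
  "cinner (copy_idx d N) (tensor_pow \<phi>) (tensor_pow \<psi>) = (cinner (box d) \<phi> \<psi>) ^ N"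
proof (induction N)
  case (Suc N)
  have "cinner (copy_idx d (Suc N)) (tensor_pow \<phi>) (tensor_pow \<psi>)
      = (\<Sum>p\<in>box d. cnj (\<phi> p) * \<psi> p * cinner (copy_idx d N) (tensor_pow \<phi>) (tensor_pow \<psi>))"
    unfolding cinner_def sum_copy_idx_Suc by (simp add: sum_distrib_left algebra_simps)
  also have "\<dots> = (cinner (box d) \<phi> \<psi>) ^ Suc N"
    unfolding Suc.IH by (simp add: cinner_def sum_distrib_right)
  finally show ?case .
qed (simp add: cinner_def)

lemma mat_vec_tensor_mat:
  "xs \<in> copy_idx d N \<Longrightarrow>
   mat_vec (copy_idx d N) (tensor_mat u) (tensor_pow \<psi>) xs = tensor_pow (mat_vec (box d) u \<psi>) xs"
proof (induction N arbitrary: xs)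
  case (Suc N)
  then obtain p ys where xs: "xs = p # ys" "ys \<in> copy_idx d N"
    by (auto elim: copy_idx_SucE)
  have "mat_vec (copy_idx d (Suc N)) (tensor_mat u) (tensor_pow \<psi>) xs
      = (\<Sum>q\<in>box d. u p q * \<psi> q * mat_vec (copy_idx d N) (tensor_mat u) (tensor_pow \<psi>) ys)"
    unfolding mat_vec_def sum_copy_idx_Suc xs by (simp add: sum_distrib_left algebra_simps)
  also have "\<dots> = tensor_pow (mat_vec (box d) u \<psi>) xs"
    unfolding Suc.IH[OF xs(2)] by (simp add: xs(1) mat_vec_def sum_distrib_right)
  finally show ?case .
qed (simp add: mat_vec_def)

lemma unitary_on_tensor_mat:
  assumes "unitary_on (box d) u"
  shows "unitary_on (copy_idx d N) (tensor_mat u)"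
proof (induction N)
  case (Suc N)
  have "(\<Sum>zs\<in>copy_idx d (Suc N). tensor_mat u xs zs * cnj (tensor_mat u ys zs)) = (if xs = ys then 1 else 0)
      \<and> (\<Sum>zs\<in>copy_idx d (Suc N). cnj (tensor_mat u zs xs) * tensor_mat u zs ys) = (if xs = ys then 1 else 0)"
    if xy: "xs \<in> copy_idx d (Suc N)" "ys \<in> copy_idx d (Suc N)" for xs ys
  proof -
    obtain p xs' where x: "xs = p # xs'" "p \<in> box d" "xs' \<in> copy_idx d N"
      using xy(1) by (rule copy_idx_SucE)
    obtain q ys' where y: "ys = q # ys'" "q \<in> box d" "ys' \<in> copy_idx d N"
      using xy(2) by (rule copy_idx_SucE)
    have "(\<Sum>zs\<in>copy_idx d (Suc N). tensor_mat u xs zs * cnj (tensor_mat u ys zs))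
        = (\<Sum>r\<in>box d. u p r * cnj (u q r)) * (\<Sum>zs\<in>copy_idx d N. tensor_mat u xs' zs * cnj (tensor_mat u ys' zs))"
      unfolding sum_copy_idx_Suc sum_product x y by (simp add: algebra_simps)
    moreover have "(\<Sum>zs\<in>copy_idx d (Suc N). cnj (tensor_mat u zs xs) * tensor_mat u zs ys)
        = (\<Sum>r\<in>box d. cnj (u r p) * u r q) * (\<Sum>zs\<in>copy_idx d N. cnj (tensor_mat u zs xs') * tensor_mat u zs ys')"
      unfolding sum_copy_idx_Suc sum_product x y by (simp add: algebra_simps)
    ultimately show ?thesis
      using assms Suc.IH x y by (simp add: unitary_on_def)
  qed
  then show ?case by (simp add: unitary_on_def)
qed (simp add: unitary_on_def)

section \<open>Local unitaries as symmetries of the testing problem\<close>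

definition loc :: "(nat \<Rightarrow> nat \<Rightarrow> complex) \<Rightarrow> nat \<times> nat \<Rightarrow> nat \<times> nat \<Rightarrow> complex" where
  "loc u p q = (if snd p = snd q then u (fst p) (fst q) else 0)"

lemma sum_box: "sum f (box d) = (\<Sum>i<d. \<Sum>j<d. f (i, j))"
  by (simp add: box_def sum.cartesian_product atLeast0LessThan)

lemma mat_vec_loc:
  "j < d \<Longrightarrow> mat_vec (box d) (loc u) \<psi> (i, j) = (\<Sum>k<d. u i k * \<psi> (k, j))"
  by (simp add: mat_vec_def loc_def sum_box if_distrib if_distribR cong: if_cong)

lemma dagger_loc: "dagger (loc u) = loc (dagger u)"
  by (auto simp: dagger_def loc_def fun_eq_iff)

lemma unitary_on_loc:
  assumes "unitary_on {..<d} u"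
  shows "unitary_on (box d) (loc u)"
  unfolding unitary_on_def
proof (intro conjI ballI)
  fix p q assume pq: "p \<in> box d" "q \<in> box d"
  obtain i j k l where p: "p = (i, j)" and q: "q = (k, l)" by (metis surj_pair)
  have lt: "i < d" "j < d" "k < d" "l < d" using pq by (auto simp: p q box_def)
  have "(\<Sum>r\<in>box d. loc u p r * cnj (loc u q r))
      = (\<Sum>z<d. \<Sum>m<d. if m = j then (if j = l then u i z * cnj (u k z) else 0) else 0)"
    unfolding sum_box by (intro sum.cong refl) (auto simp: p q loc_def)
  also have "\<dots> = (if p = q then 1 else 0)"
    using assms lt by (cases "j = l") (auto simp: unitary_on_def p q)
  finally show "(\<Sum>r\<in>box d. loc u p r * cnj (loc u q r)) = (if p = q then 1 else 0)" .
  have "(\<Sum>r\<in>box d. cnj (loc u r p) * loc u r q)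
      = (\<Sum>z<d. \<Sum>m<d. if m = j then (if j = l then cnj (u z i) * u z k else 0) else 0)"
    unfolding sum_box by (intro sum.cong refl) (auto simp: p q loc_def)
  also have "\<dots> = (if p = q then 1 else 0)"
    using assms lt by (cases "j = l") (auto simp: unitary_on_def p q)
  finally show "(\<Sum>r\<in>box d. cnj (loc u r p) * loc u r q) = (if p = q then 1 else 0)" .
qed

lemma unit_state_iff: "unit_state d \<psi> \<longleftrightarrow> sqnorm (box d) \<psi> = 1"
  by (simp add: unit_state_def sqnorm_def)

lemma pure_trace_dist_eq: "pure_trace_dist d \<psi> \<phi> = sqrt (1 - (cmod (cinner (box d) \<psi> \<phi>))\<^sup>2)"
  by (simp add: pure_trace_dist_def cinner_def)

text \<open>The reduced state is conjugated by \<open>u\<close>, and conjugation fixes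
  \<open>I/d\<close>.\<close>

lemma maximally_entangled_loc:
  assumes u: "unitary_on {..<d} u" and \<psi>: "maximally_entangled d \<psi>"
  shows "maximally_entangled d (mat_vec (box d) (loc u) \<psi>)"
proof -
  have "partial_trace_B d (mat_vec (box d) (loc u) \<psi>) i k = (if i = k then 1 / of_nat d else 0)"
    if ik: "i < d" "k < d" for i k
  proof -
    have "partial_trace_B d (mat_vec (box d) (loc u) \<psi>) i k
        = (\<Sum>j<d. \<Sum>a<d. \<Sum>b<d. u i a * cnj (u k b) * (\<psi> (a, j) * cnj (\<psi> (b, j))))"
      unfolding partial_trace_B_def
      by (intro sum.cong refl) (simp add: mat_vec_loc sum_product algebra_simps)
    also have "\<dots> = (\<Sum>a<d. \<Sum>j<d. \<Sum>b<d. u i a * cnj (u k b) * (\<psi> (a, j) * cnj (\<psi> (b, j))))"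
      by (rule sum.swap)
    also have "\<dots> = (\<Sum>a<d. \<Sum>b<d. \<Sum>j<d. u i a * cnj (u k b) * (\<psi> (a, j) * cnj (\<psi> (b, j))))"
      by (intro sum.cong refl sum.swap)
    also have "\<dots> = (\<Sum>a<d. \<Sum>b<d. u i a * cnj (u k b) * partial_trace_B d \<psi> a b)"
      by (simp add: partial_trace_B_def sum_distrib_left)
    also have "\<dots> = (\<Sum>a<d. \<Sum>b<d. u i a * cnj (u k b) * (if a = b then 1 / of_nat d else 0))"
      using \<psi> by (intro sum.cong refl) (simp add: maximally_entangled_def)
    also have "\<dots> = (\<Sum>a<d. u i a * cnj (u k a)) / of_nat d"
      by (simp add: if_distrib sum_divide_distrib cong: if_cong)
    also have "\<dots> = (if i = k then 1 / of_nat d else 0)"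
      using u ik by (simp add: unitary_on_def)
    finally show ?thesis .
  qed
  then show ?thesis
    using \<psi> u by (simp add: maximally_entangled_def unit_state_iff sqnorm_unitary unitary_on_loc)
qed

text \<open>Moving \<open>u\<close> across the overlap replaces the competitor \<open>\<phi>\<close>
  by its image under the adjoint of \<open>u\<close>, which is again maximally entangled.\<close>

lemma far_from_ME_loc:
  assumes u: "unitary_on {..<d} u" and \<psi>: "far_from_ME d \<epsilon> \<psi>"
  shows "far_from_ME d \<epsilon> (mat_vec (box d) (loc u) \<psi>)"
  unfolding far_from_ME_def
proof (intro conjI allI impI)
  show "unit_state d (mat_vec (box d) (loc u) \<psi>)"
    using \<psi> u by (simp add: far_from_ME_def unit_state_iff sqnorm_unitary unitary_on_loc)
next
  fix \<phi> assume \<phi>: "maximally_entangled d \<phi>"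
  let ?\<phi>' = "mat_vec (box d) (loc (dagger u)) \<phi>"
  have "cinner (box d) (mat_vec (box d) (loc u) \<psi>) \<phi>
      = cinner (box d) (mat_vec (box d) (loc u) \<psi>) (mat_vec (box d) (loc u) ?\<phi>')"
    using u by (intro cinner_cong) (simp_all add: mat_vec_dagger unitary_on_loc flip: dagger_loc)
  also have "\<dots> = cinner (box d) \<psi> ?\<phi>'"
    using u by (simp add: cinner_unitary unitary_on_loc)
  finally have "pure_trace_dist d (mat_vec (box d) (loc u) \<psi>) \<phi> = pure_trace_dist d \<psi> ?\<phi>'"
    by (simp add: pure_trace_dist_eq)
  moreover have "maximally_entangled d ?\<phi>'"
    using u \<phi> by (intro maximally_entangled_loc unitary_on_dagger)
  ultimately show "\<epsilon> \<le> pure_trace_dist d (mat_vec (box d) (loc u) \<psi>) \<phi>"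
    using \<psi> by (simp add: far_from_ME_def)
qed

abbreviation tform where
  "tform d N T \<phi> \<psi> \<equiv> sform (copy_idx d N) T (tensor_pow \<phi>) (tensor_pow \<psi>)"

lemma tensor_pow_cong:
  "xs \<in> copy_idx d N \<Longrightarrow> (\<And>p. p \<in> box d \<Longrightarrow> \<phi> p = \<psi> p) \<Longrightarrow> tensor_pow \<phi> xs = tensor_pow \<psi> xs"
  unfolding tensor_pow_def copy_idx_def by (intro arg_cong[where f = prod_list] map_cong) auto

lemma tform_cong:
  "(\<And>p. p \<in> box d \<Longrightarrow> \<phi> p = \<phi>' p) \<Longrightarrow> (\<And>p. p \<in> box d \<Longrightarrow> \<psi> p = \<psi>' p) \<Longrightarrow>
   tform d N T \<phi> \<psi> = tform d N T \<phi>' \<psi>'"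
  by (intro sform_cong refl tensor_pow_cong) auto

lemma tform_conj_mat:
  "tform d N (conj_mat (copy_idx d N) (tensor_mat u) T) \<phi> \<psi>
     = tform d N T (mat_vec (box d) u \<phi>) (mat_vec (box d) u \<psi>)"
  unfolding sform_conj_mat[OF finite_copy_idx] by (intro sform_cong refl mat_vec_tensor_mat)

lemma psd_on_conj_mat:
  assumes "finite A" "psd_on A T" shows "psd_on A (conj_mat A u T)"
  using assms by (simp add: psd_on_def qform_eq_sform sform_conj_mat)

lemma valid_measurement_conj_mat:
  assumes T: "valid_measurement d N T" and u: "unitary_on (copy_idx d N) u"
  shows "valid_measurement d N (conj_mat (copy_idx d N) u T)"
proof -
  let ?C = "copy_idx d N"
  have "sform ?C (\<lambda>x y. id_mat x y - conj_mat ?C u T x y) v v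
      = sform ?C (\<lambda>x y. id_mat x y - T x y) (mat_vec ?C u v) (mat_vec ?C u v)" for v
    using u by (simp add: sform_diff_mat sform_id_mat sform_conj_mat cinner_unitary)
  then show ?thesis
    using T psd_on_conj_mat[of ?C T u]
    by (simp add: valid_measurement_def psd_on_def qform_eq_sform flip: id_mat_def)
qed

lemma accept_prob_eq: "accept_prob d N T \<psi> = Re (tform d N T \<psi> \<psi>)"
  by (simp add: accept_prob_def qform_eq_sform)

lemma is_ME_tester_conj_mat:
  assumes T: "is_ME_tester d \<epsilon> N T" and u: "unitary_on {..<d} u"
  shows "is_ME_tester d \<epsilon> N (conj_mat (copy_idx d N) (tensor_mat (loc u)) T)"
  using T u
  by (simp add: is_ME_tester_def accept_prob_eq tform_conj_mat valid_measurement_conj_mat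
      unitary_on_tensor_mat unitary_on_loc maximally_entangled_loc far_from_ME_loc)

section \<open>Testers invariant under local unitaries\<close>

text \<open>Tychonoff. It will be applied to matrices indexed by the infinite type of pairs of
  lists.\<close>

lemma compact_Pi_UNIV:
  fixes S :: "'a \<Rightarrow> 'b::topological_space set"
  assumes "\<And>x. compact (S x)"
  shows "compact (Pi UNIV S)"
proof -
  have "compactin (product_topology (\<lambda>_. euclidean) UNIV) (PiE UNIV S)"
    using assms by (simp add: compactin_PiE)
  then show ?thesis
    by (simp add: euclidean_product_topology PiE_UNIV_domain)
qed

lemma continuous_on_sform_curry: "continuous_on UNIV (\<lambda>G. sform A (\<lambda>x y. G (x, y)) v w)"
  unfolding sform_def by (intro continuous_intros continuous_on_product_coordinates)

lemma psd_on_iff: "psd_on A T \<longleftrightarrow> (\<forall>v. Im (sform A T v v) = 0 \<and> 0 \<le> Re (sform A T v v))"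
  by (simp add: psd_on_def qform_eq_sform complex_is_Real_iff)

lemma psd_on_compl_iff:
  "finite A \<Longrightarrow> psd_on A (\<lambda>x y. (if x = y then 1 else 0) - T x y) \<longleftrightarrow>
    (\<forall>v. Im (sform A T v v) = 0 \<and> Re (sform A T v v) \<le> sqnorm A v)"
  by (simp add: psd_on_iff sform_diff_mat sform_id_mat cinner_self flip: id_mat_def)

lemma is_ME_tester_iff:
  "is_ME_tester d \<epsilon> N T \<longleftrightarrow>
    (\<forall>v. Im (sform (copy_idx d N) T v v) = 0 \<and> 0 \<le> Re (sform (copy_idx d N) T v v)
        \<and> Re (sform (copy_idx d N) T v v) \<le> sqnorm (copy_idx d N) v) \<and>
    (\<forall>\<psi>. maximally_entangled d \<psi> \<longrightarrow> 2/3 \<le> Re (tform d N T \<psi> \<psi>)) \<and>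
    (\<forall>\<psi>. far_from_ME d \<epsilon> \<psi> \<longrightarrow> Re (tform d N T \<psi> \<psi>) \<le> 1/3)"
  unfolding is_ME_tester_def valid_measurement_def accept_prob_eq psd_on_compl_iff[OF finite_copy_idx]
  unfolding psd_on_iff by blast

text \<open>Each clause compares a continuous function of the matrix entries with a constant.
  Matrices are uncurried so that the product topology on functions of one argument applies
  directly.\<close>

lemma closed_ME_testers: "closed {G. is_ME_tester d \<epsilon> N (\<lambda>x y. G (x, y))}"
proof -
  have *: "continuous_on UNIV (\<lambda>G. Re (sform A (\<lambda>x y. G (x, y)) v w))"
    "continuous_on UNIV (\<lambda>G. Im (sform A (\<lambda>x y. G (x, y)) v w))" for A :: "'a set" and v w
    using continuous_on_sform_curry[of A v w] by (auto intro: continuous_on_Re continuous_on_Im)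
  show ?thesis
    unfolding is_ME_tester_iff
    by (intro closed_Collect_conj closed_Collect_all closed_Collect_imp open_Collect_const;
        (rule closed_Collect_eq closed_Collect_le; rule * continuous_on_const))
qed

text \<open>A continuous function attains its minimum on a compact set. Compactness comes from
  bounding all entries by the norm of \<open>T0\<close> and from zeroing the entries outside the
  index set, which no form sees.\<close>

lemma ME_tester_frob_minimal:
  assumes "is_ME_tester d \<epsilon> N T0"
  obtains T where "is_ME_tester d \<epsilon> N T"
    "\<And>T'. is_ME_tester d \<epsilon> N T' \<Longrightarrow> frob (copy_idx d N) T \<le> frob (copy_idx d N) T'"
proof -
  let ?C = "copy_idx d N"
  let ?cur = "\<lambda>(G :: (nat \<times> nat) list \<times> (nat \<times> nat) list \<Rightarrow> complex) x y. G (x, y)"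
  define r where "r = sqrt (frob ?C T0)"
  define S where "S p = (if p \<in> ?C \<times> ?C then cball 0 r else {0 :: complex})" for p
  define K where "K = Pi UNIV S \<inter> {G. is_ME_tester d \<epsilon> N (?cur G)}"
  define res where "res T = (\<lambda>(x, y). if x \<in> ?C \<and> y \<in> ?C then T x y else (0::complex))" for T
  have tester_res: "is_ME_tester d \<epsilon> N (?cur (res T)) \<longleftrightarrow> is_ME_tester d \<epsilon> N T"
    and frob_res: "frob ?C (?cur (res T)) = frob ?C T" for T
  proof -
    have "sform ?C (?cur (res T)) v w = sform ?C T v w" for v w
      by (intro sform_cong) (auto simp: res_def)
    then show "is_ME_tester d \<epsilon> N (?cur (res T)) \<longleftrightarrow> is_ME_tester d \<epsilon> N T"
      by (simp only: is_ME_tester_iff)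
    show "frob ?C (?cur (res T)) = frob ?C T"
      unfolding frob_def by (intro sum.cong) (auto simp: res_def)
  qed
  have res_in_K: "res T \<in> K" if T: "is_ME_tester d \<epsilon> N T" "frob ?C T \<le> frob ?C T0" for T
  proof -
    have "cmod (T x y) \<le> r" if "x \<in> ?C" "y \<in> ?C" for x y
    proof -
      have "(cmod (T x y))\<^sup>2 \<le> (\<Sum>y\<in>?C. (cmod (T x y))\<^sup>2)"
        using that by (intro member_le_sum) auto
      also have "\<dots> \<le> frob ?C T"
        unfolding frob_def using that
        by (intro member_le_sum[where f = "\<lambda>x. \<Sum>y\<in>?C. (cmod (T x y))\<^sup>2"]) (auto intro: sum_nonneg)
      finally show ?thesis
        using T(2) by (simp add: r_def real_le_rsqrt)
    qed
    then show ?thesis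
      using T(1) by (auto simp: K_def S_def tester_res) (auto simp: res_def)
  qed
  have "compact (S p)" for p by (simp add: S_def)
  then have "compact K"
    unfolding K_def by (intro compact_Int_closed compact_Pi_UNIV closed_ME_testers)
  moreover have "K \<noteq> {}"
    using res_in_K[OF assms] by auto
  moreover have "continuous_on K (\<lambda>G. frob ?C (?cur G))"
    unfolding frob_def
    by (intro continuous_intros continuous_on_subset[OF continuous_on_product_coordinates]) auto
  ultimately obtain G where G: "G \<in> K" "\<And>H. H \<in> K \<Longrightarrow> frob ?C (?cur G) \<le> frob ?C (?cur H)"
    using continuous_attains_inf[of K "\<lambda>G. frob ?C (?cur G)"] by blast
  show thesis
  proof (rule that[of "?cur G"])
    show "is_ME_tester d \<epsilon> N (?cur G)"
      using G(1) by (simp add: K_def)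
    fix T' assume T': "is_ME_tester d \<epsilon> N T'"
    \<comment> \<open>A tester of larger norm than \<open>T0\<close> need not have a representative
      in \<open>K\<close>, but \<open>T0\<close> already beats it.\<close>
    have "frob ?C (?cur G) \<le> frob ?C T0"
      using G(2)[OF res_in_K[OF assms]] by (simp add: frob_res)
    moreover have "frob ?C (?cur G) \<le> frob ?C T'" if "frob ?C T' \<le> frob ?C T0"
      using G(2)[OF res_in_K[OF T' that]] by (simp add: frob_res)
    ultimately show "frob ?C (?cur G) \<le> frob ?C T'"
      by linarith
  qed
qed

lemma sform_midpoint:
  "sform A (\<lambda>x y. (S x y + T x y) / 2) v w = (sform A S v w + sform A T v w) / 2"
  unfolding sform_def sum.distrib[symmetric] sum_divide_distrib
  by (intro sum.cong refl) (simp add: field_simps)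

lemma is_ME_tester_midpoint:
  assumes S: "is_ME_tester d \<epsilon> N S" and T: "is_ME_tester d \<epsilon> N T"
  shows "is_ME_tester d \<epsilon> N (\<lambda>x y. (S x y + T x y) / 2)"
proof -
  have *: "Im ((a + b) / 2) = (Im a + Im b) / 2" "Re ((a + b) / 2) = (Re a + Re b) / 2" for a b
    by simp_all
  show ?thesis
    unfolding is_ME_tester_iff sform_midpoint *
  proof (intro conjI allI impI)
    fix v
    show "(Im (sform (copy_idx d N) S v v) + Im (sform (copy_idx d N) T v v)) / 2 = 0"
      "0 \<le> (Re (sform (copy_idx d N) S v v) + Re (sform (copy_idx d N) T v v)) / 2"
      "(Re (sform (copy_idx d N) S v v) + Re (sform (copy_idx d N) T v v)) / 2 \<le> sqnorm (copy_idx d N) v"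
      using S[unfolded is_ME_tester_iff, THEN conjunct1, rule_format, of v]
        T[unfolded is_ME_tester_iff, THEN conjunct1, rule_format, of v] by auto
  next
    fix \<psi> assume "maximally_entangled d \<psi>"
    then show "2/3 \<le> (Re (tform d N S \<psi> \<psi>) + Re (tform d N T \<psi> \<psi>)) / 2"
      using S T by (fastforce simp: is_ME_tester_def accept_prob_eq)
  next
    fix \<psi> assume "far_from_ME d \<epsilon> \<psi>"
    then show "(Re (tform d N S \<psi> \<psi>) + Re (tform d N T \<psi> \<psi>)) / 2 \<le> 1/3"
      using S T by (fastforce simp: is_ME_tester_def accept_prob_eq)
  qed
qed

lemma frob_parallelogram:
  "frob A (\<lambda>x y. (S x y + T x y) / 2) + frob A (\<lambda>x y. S x y - T x y) / 4 = (frob A S + frob A T) / 2"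
proof -
  have "(cmod ((s + t) / 2))\<^sup>2 + (cmod (s - t))\<^sup>2 / 4 = ((cmod s)\<^sup>2 + (cmod t)\<^sup>2) / 2" for s t
    unfolding cmod_power2 by (simp add: power2_eq_square field_simps)
  then show ?thesis
    unfolding frob_def sum_divide_distrib sum.distrib[symmetric]
    by (intro sum.cong refl)
qed

lemma frob_eq_0_iff: "finite A \<Longrightarrow> frob A T = 0 \<longleftrightarrow> (\<forall>x\<in>A. \<forall>y\<in>A. T x y = 0)"
  by (simp add: frob_def sum_nonneg_eq_0_iff sum_nonneg)

text \<open>The tester of least Frobenius norm is unique by the parallelogram law, hence invariant under
  every symmetry of the testing problem. This replaces averaging over the Haar measure.\<close>

lemma ME_tester_invariant:
  assumes "is_ME_tester d \<epsilon> N T0"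
  obtains T where "is_ME_tester d \<epsilon> N T"
    "\<And>u \<phi> \<psi>. unitary_on {..<d} u \<Longrightarrow>
      tform d N T (mat_vec (box d) (loc u) \<phi>) (mat_vec (box d) (loc u) \<psi>) = tform d N T \<phi> \<psi>"
proof -
  let ?C = "copy_idx d N"
  obtain T where T: "is_ME_tester d \<epsilon> N T"
    and min: "\<And>T'. is_ME_tester d \<epsilon> N T' \<Longrightarrow> frob ?C T \<le> frob ?C T'"
    using ME_tester_frob_minimal[OF assms] by blast
  show thesis
  proof (rule that[OF T])
    fix u \<phi> \<psi> assume u: "unitary_on {..<d} u"
    define T' where "T' = conj_mat ?C (tensor_mat (loc u)) T"
    have T': "is_ME_tester d \<epsilon> N T'"
      unfolding T'_def using T u by (rule is_ME_tester_conj_mat)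
    have "frob ?C T' = frob ?C T"
      unfolding T'_def using u by (simp add: frob_conj_mat unitary_on_tensor_mat unitary_on_loc)
    moreover have "frob ?C T \<le> frob ?C (\<lambda>x y. (T x y + T' x y) / 2)"
      by (intro min is_ME_tester_midpoint T T')
    ultimately have "frob ?C (\<lambda>x y. T x y - T' x y) \<le> 0"
      using frob_parallelogram[of ?C T T'] by argo
    moreover have "frob ?C (\<lambda>x y. T x y - T' x y) \<ge> 0"
      by (simp add: frob_def sum_nonneg)
    ultimately have "\<forall>x\<in>?C. \<forall>y\<in>?C. T x y = T' x y"
      using frob_eq_0_iff[of ?C "\<lambda>x y. T x y - T' x y"] by simp
    then have "tform d N T \<phi> \<psi> = tform d N T' \<phi> \<psi>"
      by (intro sform_cong) auto
    then show "tform d N T (mat_vec (box d) (loc u) \<phi>) (mat_vec (box d) (loc u) \<psi>) = tform d N T \<phi> \<psi>"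
      by (simp add: T'_def tform_conj_mat)
  qed
qed

section \<open>Positive local operators and the second moment bound\<close>

definition herm_invol :: "nat \<Rightarrow> (nat \<Rightarrow> nat \<Rightarrow> complex) \<Rightarrow> bool" where
  "herm_invol d Z \<longleftrightarrow> (\<forall>i<d. \<forall>k<d. cnj (Z i k) = Z k i) \<and>
     (\<forall>i<d. \<forall>k<d. (\<Sum>j<d. Z i j * Z j k) = (if i = k then 1 else 0))"

abbreviation loc_op :: "nat \<Rightarrow> (nat \<Rightarrow> nat \<Rightarrow> complex) \<Rightarrow> (nat \<times> nat \<Rightarrow> complex) \<Rightarrow> nat \<times> nat \<Rightarrow> complex" where
  "loc_op d u \<equiv> mat_vec (box d) (loc u)"

lemma herm_invol_unitary: "herm_invol d Z \<Longrightarrow> unitary_on {..<d} Z"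
  by (simp add: herm_invol_def unitary_on_def)

lemma loc_op_involution:
  assumes Z: "herm_invol d Z" and p: "p \<in> box d"
  shows "loc_op d Z (loc_op d Z \<psi>) p = \<psi> p"
proof -
  have "loc_op d Z (loc_op d Z \<psi>) p = loc_op d Z (loc_op d (dagger Z) \<psi>) p"
    using Z by (auto simp: mat_vec_def loc_def dagger_def box_def herm_invol_def intro!: sum.cong)
  also have "\<dots> = \<psi> p"
    using Z p unfolding dagger_loc[symmetric]
    by (intro mat_vec_dagger unitary_on_loc herm_invol_unitary) auto
  finally show ?thesis .
qed

lemma cinner_loc_op_loc_op:
  "herm_invol d Z \<Longrightarrow> cinner (box d) (loc_op d Z \<phi>) (loc_op d Z \<psi>) = cinner (box d) \<phi> \<psi>"
  by (simp add: cinner_unitary unitary_on_loc herm_invol_unitary)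

lemma cinner_loc_op_left:
  assumes "herm_invol d Z"
  shows "cinner (box d) (loc_op d Z \<phi>) \<psi> = cinner (box d) \<phi> (loc_op d Z \<psi>)"
proof -
  have "cinner (box d) (loc_op d Z \<phi>) \<psi> = cinner (box d) (loc_op d Z \<phi>) (loc_op d Z (loc_op d Z \<psi>))"
    using assms by (intro cinner_cong) (simp_all add: loc_op_involution)
  then show ?thesis
    using assms by (simp add: cinner_loc_op_loc_op)
qed

lemma mat_vec_add: "mat_vec A u (\<lambda>x. v x + w x) x = mat_vec A u v x + mat_vec A u w x"
  by (simp add: mat_vec_def algebra_simps sum.distrib)

lemma mat_vec_scale: "mat_vec A u (\<lambda>x. c * v x) x = c * mat_vec A u v x"
  by (simp add: mat_vec_def algebra_simps sum_distrib_left)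

text \<open>As \<open>Z\<close> is Hermitian with square 1, the product of
  \<open>1 + \<i> \<tau> Z\<close> and its adjoint is \<open>1 + \<tau>\<^sup>2\<close>. Up to the
  scalar \<open>n\<close> these unitaries are affine in \<open>\<tau>\<close>, which is what makes
  the later continuation in the parameter polynomial.\<close>

lemma unitary_on_rotation:
  fixes \<tau> :: real
  assumes Z: "herm_invol d Z" and n: "n\<^sup>2 = 1 + \<tau>\<^sup>2"
  shows "unitary_on {..<d} (\<lambda>i k. (id_mat i k + \<i> * \<tau> * Z i k) / of_real n)"
proof -
  have n0: "of_real n * of_real n = (1 + of_real \<tau> * of_real \<tau> :: complex)"
    using arg_cong[OF n, of complex_of_real] by (simp add: power2_eq_square)
  have nz: "of_real n \<noteq> (0 :: complex)"
    using n by (auto simp: add_nonneg_eq_0_iff)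
  \<comment> \<open>General in \<open>s\<close>, because the two products in the definition of
    unitarity are the cases \<open>s = \<i> \<tau>\<close> and
    \<open>s = - \<i> \<tau>\<close>.\<close>
  have *: "(\<Sum>z<d. (id_mat x z + s * Z x z) * (id_mat z y - s * Z z y)) = (1 - s * s) * id_mat x y"
    if xy: "x < d" "y < d" for x y and s :: complex
  proof -
    have "(\<Sum>z<d. (id_mat x z + s * Z x z) * (id_mat z y - s * Z z y))
        = (\<Sum>z<d. id_mat x z * (id_mat z y - s * Z z y)) + (\<Sum>z<d. s * Z x z * id_mat z y)
          - s * s * (\<Sum>z<d. Z x z * Z z y)"
      by (simp add: algebra_simps sum.distrib sum_subtractf sum_distrib_left sum_negf)
    also have "(\<Sum>z<d. id_mat x z * (id_mat z y - s * Z z y)) = (\<Sum>z<d. if z = x then id_mat x y - s * Z x y else 0)"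
      by (intro sum.cong) (auto simp: id_mat_def)
    also have "\<dots> = id_mat x y - s * Z x y"
      using xy by simp
    also have "(\<Sum>z<d. s * Z x z * id_mat z y) = (\<Sum>z<d. if z = y then s * Z x y else 0)"
      by (intro sum.cong) (auto simp: id_mat_def)
    also have "\<dots> = s * Z x y"
      using xy by simp
    also have "(\<Sum>z<d. Z x z * Z z y) = id_mat x y"
      using xy Z by (simp add: herm_invol_def id_mat_def)
    finally show ?thesis by (simp add: algebra_simps)
  qed
  have s1: "1 - (\<i> * \<tau>) * (\<i> * \<tau>) = of_real n * of_real n"
    and s2: "1 - (- \<i> * \<tau>) * (- \<i> * \<tau>) = of_real n * of_real n"
    unfolding n0 by (simp_all add: algebra_simps)
  show ?thesis
    unfolding unitary_on_def
  proof (intro conjI ballI)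
    fix x y assume "x \<in> {..<d}" "y \<in> {..<d}"
    then have xy: "x < d" "y < d" by auto
    have "(\<Sum>z<d. (id_mat x z + \<i> * \<tau> * Z x z) / n * cnj ((id_mat y z + \<i> * \<tau> * Z y z) / n))
       = (\<Sum>z<d. (id_mat x z + \<i> * \<tau> * Z x z) * (id_mat z y - \<i> * \<tau> * Z z y)) / (of_real n * of_real n)"
      unfolding sum_divide_distrib using Z xy
      by (intro sum.cong refl) (auto simp: herm_invol_def id_mat_def)
    then show "(\<Sum>z<d. (id_mat x z + \<i> * \<tau> * Z x z) / n * cnj ((id_mat y z + \<i> * \<tau> * Z y z) / n))
       = (if x = y then 1 else 0)"
      unfolding *[OF xy] s1 using nz by (simp add: id_mat_def)
    have "(\<Sum>z<d. cnj ((id_mat z x + \<i> * \<tau> * Z z x) / n) * ((id_mat z y + \<i> * \<tau> * Z z y) / n))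
       = (\<Sum>z<d. (id_mat x z - \<i> * \<tau> * Z x z) * (id_mat z y + \<i> * \<tau> * Z z y)) / (of_real n * of_real n)"
      unfolding sum_divide_distrib using Z xy
      by (intro sum.cong refl) (auto simp: herm_invol_def id_mat_def)
    then show "(\<Sum>z<d. cnj ((id_mat z x + \<i> * \<tau> * Z z x) / n) * ((id_mat z y + \<i> * \<tau> * Z z y) / n))
       = (if x = y then 1 else 0)"
      using *[OF xy, of "- \<i> * \<tau>", unfolded s2] nz by (simp add: id_mat_def)
  qed
qed

section \<open>From unitaries to \<open>1 + z Z\<close> by a polynomial identity\<close>

lemma tensor_pow_scale: "tensor_pow (\<lambda>p. c * \<phi> p) xs = c ^ length xs * tensor_pow \<phi> xs"
  by (induction xs) simp_all

lemma length_copy_idx: "xs \<in> copy_idx d N \<Longrightarrow> length xs = N"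
  by (simp add: copy_idx_def)

lemma tform_scale:
  "tform d N T (\<lambda>p. a * \<phi> p) (\<lambda>p. b * \<psi> p) = (cnj a * b) ^ N * tform d N T \<phi> \<psi>"
proof -
  have "tform d N T (\<lambda>p. a * \<phi> p) (\<lambda>p. b * \<psi> p)
      = sform (copy_idx d N) T (\<lambda>xs. a ^ N * tensor_pow \<phi> xs) (\<lambda>xs. b ^ N * tensor_pow \<psi> xs)"
    by (intro sform_cong) (simp_all add: tensor_pow_scale length_copy_idx)
  then show ?thesis
    by (simp add: sform_scale_left sform_scale_right power_mult_distrib)
qed

lemma cnj_tensor_pow: "cnj (tensor_pow \<phi> xs) = tensor_pow (\<lambda>p. cnj (\<phi> p)) xs"
  by (induction xs) simp_all

lemma tensor_pow_line_poly:
  "tensor_pow (\<lambda>p. \<phi> p + z * \<xi> p) xs = poly (prod_list (map (\<lambda>p. [:\<phi> p, \<xi> p:]) xs)) z"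
  by (induction xs) (simp_all add: algebra_simps)

lemma tform_line_poly_right:
  obtains P where "\<And>z. tform d N T \<phi> (\<lambda>p. \<psi> p + z * \<xi> p) = poly P z"
proof (rule that)
  show "tform d N T \<phi> (\<lambda>p. \<psi> p + z * \<xi> p) = poly (\<Sum>xs\<in>copy_idx d N. \<Sum>ys\<in>copy_idx d N.
      smult (cnj (tensor_pow \<phi> xs) * T xs ys) (prod_list (map (\<lambda>p. [:\<psi> p, \<xi> p:]) ys))) z" for z
    by (simp add: sform_def tensor_pow_line_poly poly_sum)
qed

text \<open>The form is conjugate-linear in its first slot, so the line is parametrised by
  \<open>cnj z\<close> in order that the dependence on \<open>z\<close> be polynomial.\<close>

lemma tform_line_poly_left:
  obtains P where "\<And>z. tform d N T (\<lambda>p. \<phi> p + cnj z * \<xi> p) \<psi> = poly P z"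
proof (rule that)
  show "tform d N T (\<lambda>p. \<phi> p + cnj z * \<xi> p) \<psi> = poly (\<Sum>xs\<in>copy_idx d N. \<Sum>ys\<in>copy_idx d N.
      smult (T xs ys * tensor_pow \<psi> ys) (prod_list (map (\<lambda>p. [:cnj (\<phi> p), cnj (\<xi> p):]) xs))) z" for z
    by (simp add: sform_def cnj_tensor_pow tensor_pow_line_poly[symmetric] poly_sum algebra_simps)
qed

definition loc_invariant :: "nat \<Rightarrow> nat \<Rightarrow> ((nat \<times> nat) list \<Rightarrow> (nat \<times> nat) list \<Rightarrow> complex) \<Rightarrow> bool" where
  "loc_invariant d N T \<longleftrightarrow> (\<forall>u \<phi> \<psi>. unitary_on {..<d} u \<longrightarrow>
      tform d N T (loc_op d u \<phi>) (loc_op d u \<psi>) = tform d N T \<phi> \<psi>)"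

text \<open>Invariance under \<open>u = (1 + \<i> \<tau> Z) / n\<close> is applied to
  \<open>\<phi>\<close> and \<open>(1 - \<i> \<tau> Z) \<psi>\<close>. The second vector is sent to
  \<open>n \<psi>\<close>, the first acquires a factor \<open>1 / n\<close>, and the scalars
  cancel.\<close>

lemma tform_adjoint_imaginary:
  fixes \<tau> :: real
  assumes T: "loc_invariant d N T" and Z: "herm_invol d Z"
  shows "tform d N T (\<lambda>p. \<phi> p + \<i> * \<tau> * loc_op d Z \<phi> p) \<psi>
       = tform d N T \<phi> (\<lambda>p. \<psi> p - \<i> * \<tau> * loc_op d Z \<psi> p)"
proof -
  define n where "n = sqrt (1 + \<tau>\<^sup>2)"
  define u where "u = (\<lambda>i k. (id_mat i k + \<i> * \<tau> * Z i k) / of_real n)"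
  have n: "n\<^sup>2 = 1 + \<tau>\<^sup>2" "n > 0" by (simp_all add: n_def add_pos_nonneg)
  have n0: "of_real n * of_real n = (1 + of_real \<tau> * of_real \<tau> :: complex)"
    using arg_cong[OF n(1), of complex_of_real] by (simp add: power2_eq_square)
  have U: "loc_op d u \<xi> p = inverse (of_real n) * (\<xi> p + \<i> * \<tau> * loc_op d Z \<xi> p)"
    if "p \<in> box d" for \<xi> p
  proof -
    have "loc_op d u \<xi> p = (\<Sum>q\<in>box d. inverse (of_real n) * ((if p = q then \<xi> q else 0) + \<i> * \<tau> * (loc Z p q * \<xi> q)))"
      unfolding mat_vec_def
      by (intro sum.cong refl) (auto simp: loc_def u_def id_mat_def field_simps prod_eq_iff)
    also have "\<dots> = inverse (of_real n) * (\<xi> p + \<i> * \<tau> * loc_op d Z \<xi> p)"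
      using that by (simp add: mat_vec_def sum.distrib flip: sum_distrib_left)
    finally show ?thesis .
  qed
  let ?\<psi>' = "\<lambda>p. \<psi> p + (- \<i> * \<tau>) * loc_op d Z \<psi> p"
  have U\<psi>: "loc_op d u ?\<psi>' p = of_real n * \<psi> p" if "p \<in> box d" for p
  proof -
    have "loc_op d u ?\<psi>' p = inverse (of_real n) * ((of_real n * of_real n) * \<psi> p)"
      unfolding U[OF that] mat_vec_add mat_vec_scale loc_op_involution[OF Z that] n0
      by (simp add: algebra_simps)
    then show ?thesis
      using n(2) by simp
  qed
  have "unitary_on {..<d} u"
    unfolding u_def using Z n(1) by (rule unitary_on_rotation)
  then have "tform d N T \<phi> ?\<psi>' = tform d N T (loc_op d u \<phi>) (loc_op d u ?\<psi>')"
    using T by (simp add: loc_invariant_def)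
  also have "\<dots> = tform d N T (\<lambda>p. inverse (of_real n) * (\<phi> p + \<i> * \<tau> * loc_op d Z \<phi> p)) (\<lambda>p. of_real n * \<psi> p)"
    by (intro tform_cong U U\<psi>)
  also have "\<dots> = tform d N T (\<lambda>p. \<phi> p + \<i> * \<tau> * loc_op d Z \<phi> p) \<psi>"
    unfolding tform_scale using n(2) by simp
  finally show ?thesis by simp
qed

text \<open>Both sides are polynomials in \<open>z\<close> that agree on the imaginary axis, where
  \<open>1 + z Z\<close> is proportional to a unitary.\<close>

lemma tform_adjoint:
  assumes T: "loc_invariant d N T" and Z: "herm_invol d Z"
  shows "tform d N T (\<lambda>p. \<phi> p + cnj z * loc_op d Z \<phi> p) \<psi>
       = tform d N T \<phi> (\<lambda>p. \<psi> p + z * loc_op d Z \<psi> p)"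
proof -
  obtain P where P: "\<And>z. tform d N T (\<lambda>p. \<phi> p + cnj z * loc_op d Z \<phi> p) \<psi> = poly P z"
    using tform_line_poly_left[of d N T \<phi> "loc_op d Z \<phi>" \<psi>] by blast
  obtain Q where Q: "\<And>z. tform d N T \<phi> (\<lambda>p. \<psi> p + z * loc_op d Z \<psi> p) = poly Q z"
    using tform_line_poly_right[of d N T \<phi> \<psi> "loc_op d Z \<psi>"] by blast
  \<comment> \<open>The parameter is \<open>- \<i> \<tau>\<close> because its conjugate is what
    enters the left slot.\<close>
  have "poly (P - Q) (- \<i> * of_real \<tau>) = 0" for \<tau> :: real
    using tform_adjoint_imaginary[OF T Z, of \<phi> \<tau> \<psi>] P[of "- \<i> * \<tau>"] Q[of "- \<i> * \<tau>"] by simp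
  then have "range (\<lambda>\<tau>::real. - \<i> * of_real \<tau>) \<subseteq> {z. poly (P - Q) z = 0}"
    by blast
  moreover have "infinite (range (\<lambda>\<tau>::real. - \<i> * of_real \<tau>))"
    by (subst finite_image_iff) (auto intro: injI simp: infinite_UNIV_char_0)
  ultimately have "P - Q = 0"
    using poly_roots_finite[of "P - Q"] finite_subset by blast
  then show ?thesis
    by (simp add: P Q)
qed

text \<open>Let \<open>v\<close> be the tensor power of \<open>\<omega>\<close>, \<open>g\<close>
  the average of the tensor powers of the \<open>\<phi> e\<close>, and \<open>w = g - v\<close>,
  which is orthogonal to \<open>v\<close>. The hypotheses give \<open>2 * q v - S \<ge> 2/3\<close>,
  and an operator between 0 and 1 achieves this only if \<open>w\<close> has squared norm at least
  4/9. Then \<open>g\<close> has squared norm at least 13/9, and that norm expands into the pairwise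
  overlaps.\<close>

lemma average_overlap_ge:
  assumes T: "valid_measurement d N T" and E: "finite E" "E \<noteq> {}"
    and unit: "cinner (box d) \<omega> \<omega> = 1"
    and overlap: "\<And>e. e \<in> E \<Longrightarrow> cinner (box d) \<omega> (\<phi> e) = 1"
    and yes: "2/3 \<le> Re (tform d N T \<omega> \<omega>)"
    and no: "\<And>e. e \<in> E \<Longrightarrow> Re (tform d N T \<omega> (\<phi> e)) + Re (tform d N T (\<phi> e) \<omega>) \<le> 2/3"
  shows "13/9 * (real (card E))\<^sup>2 \<le> (\<Sum>e\<in>E. \<Sum>e'\<in>E. Re (cinner (box d) (\<phi> e) (\<phi> e') ^ N))"
proof -
  let ?C = "copy_idx d N"
  define m where "m = real (card E)"
  have m: "m > 0" using E by (simp add: m_def card_gt_0_iff)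
  define v where "v = tensor_pow \<omega>"
  define g where "g = (\<lambda>xs. inverse (of_real m) * (\<Sum>e\<in>E. tensor_pow (\<phi> e) xs))"
  define q where "q = (\<lambda>x. Re (sform ?C T x x))"
  define S where "S = Re (sform ?C T v g) + Re (sform ?C T g v)"
  have q_bounds: "0 \<le> q x" "q x \<le> sqnorm ?C x" for x
    using T unfolding valid_measurement_def psd_on_compl_iff[OF finite_copy_idx]
    by (auto simp: psd_on_iff q_def)
  have vg: "cinner ?C v g = 1"
  proof -
    have "cinner ?C v g = inverse (of_real m) * (\<Sum>e\<in>E. cinner (box d) \<omega> (\<phi> e) ^ N)"
      by (simp add: v_def g_def cinner_scale_right cinner_sum_right cinner_tensor_pow)
    then show ?thesis
      using m overlap by (simp add: m_def)
  qed
  then have gv: "cinner ?C g v = 1"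
    using cnj_cinner[of ?C v g] by simp
  have vv: "cinner ?C v v = 1"
    by (simp add: v_def cinner_tensor_pow unit)
  have sq: "sqnorm ?C (\<lambda>x. of_real a * v x + of_real b * g x) = a\<^sup>2 + 2 * a * b + b\<^sup>2 * sqnorm ?C g" for a b
    unfolding sqnorm_eq_cinner
    by (simp add: cinner_add_left cinner_add_right cinner_scale_left cinner_scale_right vg gv vv
        power2_eq_square algebra_simps)
  have qq: "q (\<lambda>x. of_real a * v x + of_real b * g x) = a\<^sup>2 * q v + a * b * S + b\<^sup>2 * q g" for a b
    unfolding q_def S_def
    by (simp add: sform_add_left sform_add_right sform_scale_left sform_scale_right
        power2_eq_square algebra_simps)
  \<comment> \<open>The two vectors are \<open>v + s w\<close> and \<open>v - s w\<close> with
    \<open>s = 3/2\<close>. Subtracting the two bounds eliminates \<open>q g\<close> and gives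
    \<open>2 s (2 q v - S)\<close> at most 1 plus \<open>s\<^sup>2\<close> times the squared norm of
    \<open>w\<close>; this \<open>s\<close> is the optimal choice when
    \<open>2 q v - S = 2/3\<close>.\<close>
  have "0 \<le> q (\<lambda>x. of_real (-1/2) * v x + of_real (3/2) * g x)"
    by (rule q_bounds)
  moreover have "q (\<lambda>x. of_real (5/2) * v x + of_real (-3/2) * g x)
      \<le> sqnorm ?C (\<lambda>x. of_real (5/2) * v x + of_real (-3/2) * g x)"
    by (rule q_bounds)
  ultimately have main: "6 * q v - 3 * S \<le> 9/4 * sqnorm ?C g - 5/4"
    unfolding sq qq by (simp add: power2_eq_square)
  have "S = inverse m * (\<Sum>e\<in>E. Re (tform d N T \<omega> (\<phi> e)) + Re (tform d N T (\<phi> e) \<omega>))"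
    by (simp add: S_def v_def g_def sform_scale_left sform_scale_right sform_sum_left sform_sum_right
        sum.distrib distrib_left flip: of_real_inverse)
  also have "\<dots> \<le> inverse m * (\<Sum>e\<in>E. 2/3)"
    using m no by (intro mult_left_mono sum_mono) auto
  also have "\<dots> = 2/3" using m by (simp add: m_def)
  finally have "S \<le> 2/3" .
  moreover have "2/3 \<le> q v"
    using yes by (simp add: q_def v_def)
  ultimately have "13/9 \<le> sqnorm ?C g"
    using main by linarith
  also have "sqnorm ?C g = inverse m * (inverse m * (\<Sum>e\<in>E. \<Sum>e'\<in>E. Re (cinner (box d) (\<phi> e) (\<phi> e') ^ N)))"
    by (simp add: sqnorm_eq_cinner g_def cinner_scale_left cinner_scale_right cinner_sum_left
        cinner_sum_right cinner_tensor_pow flip: of_real_inverse)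
  finally show ?thesis
    using m by (simp add: m_def[symmetric] field_simps power2_eq_square)
qed

section \<open>An ensemble of Hermitian involutions\<close>

lemma sinh_le_mult_cosh:
  fixes x :: real
  assumes "0 \<le> x"
  shows "sinh x \<le> x * cosh x"
proof -
  have "(\<lambda>x. x * cosh x - sinh x) 0 \<le> (\<lambda>x. x * cosh x - sinh x) x"
  proof (rule DERIV_nonneg_imp_nondecreasing[OF assms])
    fix y :: real assume "0 \<le> y"
    then show "\<exists>D. ((\<lambda>x. x * cosh x - sinh x) has_real_derivative D) (at y) \<and> 0 \<le> D"
      by (intro exI[of _ "y * sinh y"] conjI) (auto intro!: derivative_eq_intros)
  qed
  then show ?thesis by simp
qed

text \<open>For nonnegative arguments compare logarithms: their difference vanishes at 0 and has
  derivative \<open>x - tanh x\<close>, which is nonnegative by the previous lemma. Evenness gives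
  the rest.\<close>

lemma cosh_le_exp_half_square: "cosh x \<le> exp (x\<^sup>2 / 2)" for x :: real
proof -
  have *: "cosh x \<le> exp (x\<^sup>2 / 2)" if "0 \<le> x" for x :: real
  proof -
    have "(\<lambda>x. x\<^sup>2 / 2 - ln (cosh x)) 0 \<le> (\<lambda>x. x\<^sup>2 / 2 - ln (cosh x)) x"
    proof (rule DERIV_nonneg_imp_nondecreasing[OF that])
      fix y :: real assume "0 \<le> y"
      then have "0 \<le> y - sinh y / cosh y"
        using sinh_le_mult_cosh[of y] by (simp add: divide_simps cosh_real_pos)
      then show "\<exists>D. ((\<lambda>x. x\<^sup>2 / 2 - ln (cosh x)) has_real_derivative D) (at y) \<and> 0 \<le> D"
        by (intro exI[of _ "y - sinh y / cosh y"] conjI)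
          (auto intro!: derivative_eq_intros simp: cosh_real_pos)
    qed
    then have "ln (cosh x) \<le> x\<^sup>2 / 2" by simp
    then show ?thesis
      by (metis cosh_real_pos exp_le_cancel_iff exp_ln)
  qed
  show ?thesis
    using *[of x] *[of "- x"] by (cases "0 \<le> x") auto
qed

lemma exp_plus_exp_minus_le: "exp (- x) + exp x \<le> 2 * exp (x\<^sup>2 / 2)" for x :: real
  using cosh_le_exp_half_square[of x] by (simp add: cosh_def)

text \<open>Extensional functions, so that each pattern of \<open>n\<close> signs is counted exactly
  once and uniform averages are finite sums.\<close>

definition signs :: "nat \<Rightarrow> (nat \<Rightarrow> real) set" where
  "signs n = {..<n} \<rightarrow>\<^sub>E {- 1, 1}"

lemma finite_signs [simp]: "finite (signs n)"
  by (simp add: signs_def finite_PiE)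

lemma card_signs [simp]: "card (signs n) = 2 ^ n"
  by (simp add: signs_def card_PiE numeral_2_eq_2)

lemma signs_square: "a \<in> signs n \<Longrightarrow> k < n \<Longrightarrow> a k * a k = 1"
  by (fastforce simp: signs_def PiE_def Pi_def)

lemma signs_cases: "a \<in> signs n \<Longrightarrow> k < n \<Longrightarrow> a k = - 1 \<or> a k = 1"
  by (fastforce simp: signs_def PiE_def Pi_def)

lemma sum_signs_Suc: "sum f (signs (Suc n)) = (\<Sum>a\<in>signs n. f (a(n := - 1)) + f (a(n := 1)))"
proof -
  have "sum f (signs (Suc n)) = (\<Sum>(\<beta>, a)\<in>{- 1, 1} \<times> signs n. f (a(n := \<beta>)))"
    unfolding signs_def lessThan_Suc PiE_insert_eq
    by (subst sum.reindex[OF inj_combinator]) (auto simp: case_prod_unfold comp_def)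
  also have "\<dots> = (\<Sum>\<beta>\<in>{- 1, 1}. \<Sum>a\<in>signs n. f (a(n := \<beta>)))"
    by (simp add: sum.cartesian_product)
  finally show ?thesis
    by (simp add: sum.distrib)
qed

text \<open>Induction with \<open>u\<close> varying. Averaging over the last sign turns
  \<open>exp (u * (A + \<beta>)\<^sup>2)\<close> into
  \<open>exp (u * A\<^sup>2 + u) * cosh (2 * u * A)\<close>, at most
  \<open>exp u * exp ((u + 2 * u\<^sup>2) * A\<^sup>2)\<close>. The rate thus grows to
  \<open>?u'\<close>, and the bound on \<open>n * u\<close> is just strong enough to survive this
  and to absorb the extra exponent.\<close>

lemma sum_exp_square_signs:
  assumes "0 \<le> u" "4 * real n * u \<le> 1" "\<And>k. k < n \<Longrightarrow> s k = - 1 \<or> s k = (1::real)"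
  shows "(\<Sum>a\<in>signs n. exp (u * (\<Sum>k<n. a k * s k)\<^sup>2)) \<le> 2 ^ n * exp (2 * real n * u)"
  using assms
proof (induction n arbitrary: u)
  case 0
  then show ?case by (simp add: signs_def)
next
  case (Suc n)
  let ?A = "\<lambda>a. \<Sum>k<n. a k * s k"
  let ?u' = "u + 2 * u\<^sup>2"
  have nu: "4 * real n * u + 4 * u \<le> 1" "0 \<le> u"
    using Suc.prems by (simp_all add: algebra_simps)
  have nu1: "4 * real n * u \<le> 1"
    using nu by linarith
  have nu2: "4 * real n * u * u \<le> u"
    using mult_right_mono[OF nu1 nu(2)] by simp
  have step: "exp (u * (?A (a(n := - 1)) + - 1 * s n)\<^sup>2) + exp (u * (?A (a(n := 1)) + 1 * s n)\<^sup>2)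
      \<le> 2 * exp u * exp (?u' * (?A a)\<^sup>2)" for a
  proof -
    have upd: "?A (a(n := \<beta>)) = ?A a" for \<beta>
      by (intro sum.cong) auto
    let ?x = "2 * u * ?A a * s n"
    have s2: "s n * s n = 1"
      using Suc.prems(3)[of n] by auto
    have e: "u * (?A a + \<beta> * s n)\<^sup>2 = u * (?A a)\<^sup>2 + u + \<beta> * ?x" if "\<beta> * \<beta> = 1" for \<beta>
    proof -
      have "u * (?A a + \<beta> * s n)\<^sup>2 = u * (?A a)\<^sup>2 + u * (\<beta> * \<beta>) * (s n * s n) + \<beta> * ?x"
        by (simp add: power2_eq_square algebra_simps)
      then show ?thesis by (simp add: that s2)
    qed
    have e1: "u * (?A a + - 1 * s n)\<^sup>2 = u * (?A a)\<^sup>2 + u + - 1 * ?x"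
      and e2: "u * (?A a + 1 * s n)\<^sup>2 = u * (?A a)\<^sup>2 + u + 1 * ?x"
      by (rule e; simp)+
    have x2: "?x\<^sup>2 / 2 = 2 * u\<^sup>2 * (?A a)\<^sup>2"
    proof -
      have "?x\<^sup>2 / 2 = 2 * u\<^sup>2 * (?A a)\<^sup>2 * (s n * s n)"
        by (simp add: power2_eq_square algebra_simps)
      then show ?thesis by (simp add: s2)
    qed
    have "exp (u * (?A a + - 1 * s n)\<^sup>2) + exp (u * (?A a + 1 * s n)\<^sup>2)
        = exp (u * (?A a)\<^sup>2 + u) * (exp (- ?x) + exp ?x)"
      unfolding e1 e2
      by (simp only: exp_add distrib_left mult_1_left mult_minus1)
    also have "\<dots> \<le> exp (u * (?A a)\<^sup>2 + u) * (2 * exp (2 * u\<^sup>2 * (?A a)\<^sup>2))"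
      using exp_plus_exp_minus_le[of ?x] unfolding x2 by (intro mult_left_mono) auto
    also have "\<dots> = 2 * exp u * exp (?u' * (?A a)\<^sup>2)"
      by (simp add: exp_add algebra_simps)
    finally show ?thesis unfolding upd .
  qed
  have "(\<Sum>a\<in>signs (Suc n). exp (u * (\<Sum>k<Suc n. a k * s k)\<^sup>2))
      = (\<Sum>a\<in>signs n. exp (u * (?A (a(n := - 1)) + - 1 * s n)\<^sup>2) + exp (u * (?A (a(n := 1)) + 1 * s n)\<^sup>2))"
    unfolding sum_signs_Suc by simp
  also have "\<dots> \<le> (\<Sum>a\<in>signs n. 2 * exp u * exp (?u' * (?A a)\<^sup>2))"
    by (intro sum_mono step)
  also have "\<dots> = 2 * exp u * (\<Sum>a\<in>signs n. exp (?u' * (?A a)\<^sup>2))"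
    by (simp add: sum_distrib_left)
  also have "\<dots> \<le> 2 * exp u * (2 ^ n * exp (2 * real n * ?u'))"
  proof (intro mult_left_mono Suc.IH)
    show "4 * real n * ?u' \<le> 1"
      using nu nu2 by (simp add: algebra_simps power2_eq_square)
  qed (use Suc.prems in auto)
  also have "\<dots> = 2 ^ Suc n * exp (u + 2 * real n * ?u')"
    by (simp add: exp_add)
  also have "\<dots> \<le> 2 ^ Suc n * exp (2 * real (Suc n) * u)"
    using nu2 by (simp add: algebra_simps power2_eq_square)
  finally show ?case .
qed

text \<open>The sum factorises over the coordinates, and every factor is \<open>2 * cosh y\<close>
  whatever the sign \<open>s k\<close>.\<close>

lemma sum_exp_linear_signs:
  assumes s: "\<And>k. k < n \<Longrightarrow> s k = - 1 \<or> s k = (1::real)"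
  shows "(\<Sum>b\<in>signs n. exp (y * (\<Sum>k<n. b k * s k))) \<le> 2 ^ n * exp (real n * y\<^sup>2 / 2)"
proof -
  have "(\<Sum>b\<in>signs n. exp (y * (\<Sum>k<n. b k * s k))) = (\<Sum>b\<in>signs n. \<Prod>k<n. exp (y * (b k * s k)))"
    by (simp add: sum_distrib_left exp_sum)
  also have "\<dots> = (\<Prod>k<n. \<Sum>\<beta>\<in>{- 1, 1}. exp (y * (\<beta> * s k)))"
    unfolding signs_def by (subst prod_sum_PiE) auto
  also have "\<dots> = (\<Prod>k<n. exp (- y) + exp y)"
    using s by (intro prod.cong refl) (fastforce simp: add.commute)
  also have "\<dots> = (exp (- y) + exp y) ^ n"
    by simp
  also have "\<dots> \<le> (2 * exp (y\<^sup>2 / 2)) ^ n"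
    by (intro power_mono exp_plus_exp_minus_le) (simp add: add_nonneg_nonneg)
  also have "\<dots> = 2 ^ n * exp (real n * y\<^sup>2 / 2)"
    by (simp add: power_mult_distrib flip: exp_of_nat_mult)
  finally show ?thesis .
qed

text \<open>Summing over \<open>b\<close> with \<open>a\<close> fixed leaves a Gaussian-type
  exponent \<open>\<kappa>\<^sup>2 / (2 * n)\<close> times the square of the \<open>a\<close>-sum.
  The square lemma then applies with \<open>u = \<kappa>\<^sup>2 / (2 * n)\<close>, for which its
  smallness condition reads \<open>2 * \<kappa>\<^sup>2 \<le> 1\<close>.\<close>

lemma sum_exp_product_signs:
  assumes n: "n > 0" and \<kappa>: "2 * \<kappa>\<^sup>2 \<le> 1"
    and s: "\<And>k. k < n \<Longrightarrow> s k = - 1 \<or> s k = (1::real)"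
    and t: "\<And>k. k < n \<Longrightarrow> t k = - 1 \<or> t k = (1::real)"
  shows "(\<Sum>a\<in>signs n. \<Sum>b\<in>signs n. exp (\<kappa> * (\<Sum>k<n. a k * s k) * (\<Sum>k<n. b k * t k) / real n))
    \<le> 4 ^ n * exp (\<kappa>\<^sup>2)"
proof -
  let ?A = "\<lambda>a. \<Sum>k<n. a k * s k"
  have "(\<Sum>b\<in>signs n. exp (\<kappa> * ?A a * (\<Sum>k<n. b k * t k) / real n))
      \<le> 2 ^ n * exp (\<kappa>\<^sup>2 / (2 * real n) * (?A a)\<^sup>2)" for a
    using sum_exp_linear_signs[where n = n and s = t and y = "\<kappa> * ?A a / real n", OF t] n
    by (simp add: power2_eq_square field_simps)
  then have "(\<Sum>a\<in>signs n. \<Sum>b\<in>signs n. exp (\<kappa> * ?A a * (\<Sum>k<n. b k * t k) / real n))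
      \<le> (\<Sum>a\<in>signs n. 2 ^ n * exp (\<kappa>\<^sup>2 / (2 * real n) * (?A a)\<^sup>2))"
    by (rule sum_mono)
  also have "\<dots> \<le> 2 ^ n * (2 ^ n * exp (2 * real n * (\<kappa>\<^sup>2 / (2 * real n))))"
    unfolding sum_distrib_left[symmetric]
    using n \<kappa> s by (intro mult_left_mono sum_exp_square_signs) auto
  also have "\<dots> = 4 ^ n * exp (\<kappa>\<^sup>2)"
    using n by (simp add: power_mult_distrib[symmetric] mult.assoc[symmetric])
  finally show ?thesis .
qed

section \<open>The discrete Fourier transform and block involutions built from it\<close>

definition dft :: "nat \<Rightarrow> nat \<Rightarrow> nat \<Rightarrow> complex" where
  "dft h m i = cis (2 * pi * real m * real i / real h) / of_real (sqrt (real h))"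

lemma dft_commute: "dft h m i = dft h i m"
  by (simp add: dft_def mult.assoc mult.left_commute mult.commute)

lemma cmod_dft: "h > 0 \<Longrightarrow> dft h m i * cnj (dft h m i) = 1 / of_nat h"
  by (simp add: dft_def cis_cnj cis_mult flip: of_real_mult)

lemma dft_orthogonal:
  assumes "m < h" "n < h"
  shows "(\<Sum>i<h. dft h m i * cnj (dft h n i)) = (if m = n then 1 else 0)"
proof (cases "m = n")
  case True
  then show ?thesis using assms by (simp add: cmod_dft)
next
  case False
  define \<theta> where "\<theta> = 2 * pi * (real m - real n) / real h"
  have h: "h > 0" using assms by simp
  have "cis \<theta> ^ i = cis (2 * pi * real m * real i / real h - 2 * pi * real n * real i / real h)" for i
    unfolding Complex.DeMoivre
    by (rule arg_cong[where f = cis]) (simp add: \<theta>_def diff_divide_distrib algebra_simps)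
  then have "dft h m i * cnj (dft h n i) = cis \<theta> ^ i / of_nat h" for i
    using h by (simp add: dft_def cis_cnj cis_mult flip: of_real_mult)
  then have "(\<Sum>i<h. dft h m i * cnj (dft h n i)) = (\<Sum>i<h. cis \<theta> ^ i) / of_nat h"
    by (simp add: sum_divide_distrib)
  \<comment> \<open>Otherwise \<open>h\<close> would divide \<open>m - n\<close>, impossible for
    distinct indices below \<open>h\<close>. So the geometric sum formula applies, and its numerator
    vanishes.\<close>
  also have "cis \<theta> \<noteq> 1"
  proof
    assume "cis \<theta> = 1"
    then have "cos \<theta> = 1"
      by (metis cis.sel(1) one_complex.sel(1))
    then obtain k :: int where "\<theta> = of_int k * (2 * pi)"
      by (auto simp: cos_one_2pi_int mult.assoc)
    then have "2 * pi * (real m - real n - of_int k * real h) = 0"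
      using h by (simp add: \<theta>_def field_simps)
    then have "real m - real n = of_int k * real h"
      by simp
    then have "int m - int n = k * int h"
      by (metis of_int_diff of_int_eq_iff of_int_mult of_int_of_nat_eq)
    then have "int m mod int h = int n mod int h"
      by (metis cancel_comm_monoid_add_class.diff_cancel mod_eq_dvd_iff dvd_triv_right)
    then show False
      using assms False by simp
  qed
  then have "(\<Sum>i<h. cis \<theta> ^ i) = (1 - cis \<theta> ^ h) / (1 - cis \<theta>)"
    by (simp add: sum_gp_strict)
  also have "cis \<theta> ^ h = cis (2 * pi * (of_int (int m - int n)))"
    using h by (simp add: Complex.DeMoivre \<theta>_def)
  also have "\<dots> = 1"
    by (rule cis_multiple_2pi) auto
  finally show ?thesis using False by simp
qed

text \<open>The circulant matrix with eigenvalues \<open>b m\<close> in the Fourier basis. Products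
  multiply the eigenvalue sequences, and sign sequences give Hermitian involutions.\<close>

definition circ :: "nat \<Rightarrow> (nat \<Rightarrow> real) \<Rightarrow> nat \<Rightarrow> nat \<Rightarrow> complex" where
  "circ h b i k = (\<Sum>m<h. of_real (b m) * dft h m i * cnj (dft h m k))"

lemma cnj_circ: "cnj (circ h b i k) = circ h b k i"
  by (simp add: circ_def mult.assoc mult.left_commute mult.commute)

lemma circ_mult: "(\<Sum>j<h. circ h b i j * circ h c j k) = circ h (\<lambda>m. b m * c m) i k"
proof -
  have "(\<Sum>j<h. circ h b i j * circ h c j k)
      = (\<Sum>j<h. \<Sum>m<h. \<Sum>n<h. b m * c n * dft h m i * cnj (dft h n k) * (dft h n j * cnj (dft h m j)))"
    unfolding circ_def sum_product by (intro sum.cong refl) (simp add: mult_ac)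
  also have "\<dots> = (\<Sum>m<h. \<Sum>j<h. \<Sum>n<h. b m * c n * dft h m i * cnj (dft h n k) * (dft h n j * cnj (dft h m j)))"
    by (rule sum.swap)
  also have "\<dots> = (\<Sum>m<h. \<Sum>n<h. \<Sum>j<h. b m * c n * dft h m i * cnj (dft h n k) * (dft h n j * cnj (dft h m j)))"
    by (intro sum.cong refl sum.swap)
  also have "\<dots> = (\<Sum>m<h. \<Sum>n<h. if n = m then b m * c m * dft h m i * cnj (dft h m k) else 0)"
    unfolding sum_distrib_left[symmetric]
    by (intro sum.cong refl) (auto simp: dft_orthogonal)
  also have "\<dots> = circ h (\<lambda>m. b m * c m) i k"
    by (simp add: circ_def)
  finally show ?thesis .
qed

lemma circ_one:
  assumes "i < h" "k < h" "\<And>m. m < h \<Longrightarrow> b m = 1"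
  shows "circ h b i k = (if i = k then 1 else 0)"
proof -
  have "circ h b i k = (\<Sum>m<h. dft h i m * cnj (dft h k m))"
    unfolding circ_def using assms(3) by (intro sum.cong) (simp_all add: dft_commute)
  then show ?thesis
    using assms by (simp add: dft_orthogonal)
qed

text \<open>All entries of the transform have squared modulus \<open>1 / h\<close>, so every
  diagonal entry is the mean of the eigenvalues.\<close>

lemma circ_diag: "h > 0 \<Longrightarrow> circ h b i i = of_real ((\<Sum>m<h. b m) / real h)"
  by (simp add: circ_def mult.assoc cmod_dft sum_divide_distrib)

text \<open>The off-diagonal block is the unitary \<open>F\<^sup>* diag(b) F diag(a)\<close>, with \<open>F\<close> the discrete
  Fourier transform of size \<open>h\<close>. As \<open>F\<close> is flat, the traces of \<open>b\<close> and \<open>a\<close> decouple in overlaps.\<close>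

definition refl_mat :: "nat \<Rightarrow> (nat \<Rightarrow> real) \<Rightarrow> (nat \<Rightarrow> real) \<Rightarrow> nat \<Rightarrow> nat \<Rightarrow> complex" where
  "refl_mat h a b i k =
    (if i < h then (if h \<le> k \<and> k < 2 * h then circ h b i (k - h) * of_real (a (k - h)) else 0)
     else if i < 2 * h then (if k < h then of_real (a (i - h)) * circ h b (i - h) k else 0)
     else if i = k then 1 else 0)"

lemma sum_lessThan_add: "(\<Sum>i<m + n. f i) = (\<Sum>i<m. f i) + (\<Sum>i<n. f (m + i :: nat))"
  for f :: "nat \<Rightarrow> 'a::comm_monoid_add"
  by (induction n) (simp_all add: add.assoc)

lemma sum_lessThan_blocks:
  "(\<Sum>i<2 * h + r. f i) = (\<Sum>i<h. f i) + (\<Sum>i<h. f (h + i)) + (\<Sum>i<r. f (2 * h + i))"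
  for f :: "nat \<Rightarrow> 'a::comm_monoid_add"
  using sum_lessThan_add[of f "2 * h" r] sum_lessThan_add[of f h h] by (simp add: mult_2)

text \<open>The matrix has two off-diagonal blocks, \<open>W\<close> and its adjoint, where
  \<open>W\<close> is a circulant involution times a diagonal of signs. As \<open>W\<close> is
  unitary, the square is the identity. The identity on the last \<open>r\<close> indices
  accommodates odd dimensions.\<close>

lemma herm_invol_refl_mat:
  assumes a: "a \<in> signs h" and b: "b \<in> signs h"
  shows "herm_invol (2 * h + r) (refl_mat h a b)"
proof -
  have cc: "(\<Sum>j<h. circ h b i j * circ h b j k) = (if i = k then 1 else 0)" if "i < h" "k < h" for i k
    unfolding circ_mult using b that by (intro circ_one) (auto simp: signs_square)
  have aa: "of_real (a j) * of_real (a j) = (1 :: complex)" if "j < h" for j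
    using signs_square[OF a that] by (metis of_real_1 of_real_mult)
  have "(\<Sum>j<2 * h + r. refl_mat h a b i j * refl_mat h a b j k) = (if i = k then 1 else 0)"
    if ik: "i < 2 * h + r" "k < 2 * h + r" for i k
  proof -
    consider "i < h" | i' where "i = h + i'" "i' < h" | "2 * h \<le> i"
      by (metis add_diff_inverse_nat add_less_cancel_left mult_2 not_le)
    then show ?thesis
    proof cases
      case 1
      have "(\<Sum>j<2 * h + r. refl_mat h a b i j * refl_mat h a b j k)
          = (\<Sum>j<h. if k < h then (of_real (a j) * of_real (a j)) * (circ h b i j * circ h b j k) else 0)"
        unfolding sum_lessThan_blocks using 1 by (auto simp: refl_mat_def intro!: sum.cong)
      also have "\<dots> = (if k < h then (\<Sum>j<h. circ h b i j * circ h b j k) else 0)"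
        by (auto simp: aa)
      finally show ?thesis using 1 by (auto simp: cc)
    next
      case 2
      have "(\<Sum>j<2 * h + r. refl_mat h a b i j * refl_mat h a b j k)
          = (\<Sum>j<h. if h \<le> k \<and> k < 2 * h then (of_real (a i') * of_real (a (k - h))) * (circ h b i' j * circ h b j (k - h)) else 0)"
        unfolding sum_lessThan_blocks using 2 by (auto simp: refl_mat_def intro!: sum.cong)
      also have "\<dots> = (if h \<le> k \<and> k < 2 * h then (of_real (a i') * of_real (a (k - h))) * (\<Sum>j<h. circ h b i' j * circ h b j (k - h)) else 0)"
        by (auto simp: sum_distrib_left)
      finally show ?thesis using 2 by (auto simp: cc aa)
    next
      case 3
      then have "(\<Sum>j<2 * h + r. refl_mat h a b i j * refl_mat h a b j k)
          = (\<Sum>j<2 * h + r. if j = i then (if i = k then 1 else 0) else 0)"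
        by (intro sum.cong refl) (auto simp: refl_mat_def)
      then show ?thesis using ik by simp
    qed
  qed
  moreover have "cnj (refl_mat h a b i k) = refl_mat h a b k i" for i k
    by (auto simp: refl_mat_def cnj_circ mult.commute)
  ultimately show ?thesis
    by (simp add: herm_invol_def)
qed

lemma trace_refl_mat: "(\<Sum>i<2 * h + r. refl_mat h a b i i) = of_nat r"
  unfolding sum_lessThan_blocks by (simp add: refl_mat_def)

text \<open>A row or column sum of products of circulant entries is a diagonal entry of the
  circulant of \<open>b * b'\<close>, hence the same for every row and column. The sum over
  \<open>a * a'\<close> therefore factors out, once for each of the two off-diagonal blocks.\<close>

lemma overlap_refl_mat:
  assumes h: "h > 0"
  shows "(\<Sum>i<2 * h + r. \<Sum>k<2 * h + r. cnj (refl_mat h a b i k) * refl_mat h a' b' i k)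
    = of_real (real r + 2 * (\<Sum>k<h. a k * a' k) * (\<Sum>k<h. b k * b' k) / real h)"
proof -
  let ?B = "(\<Sum>k<h. b k * b' k) / real h"
  have col: "(\<Sum>i<h. cnj (circ h b i k) * circ h b' i k) = of_real ?B" for k
    unfolding cnj_circ circ_mult by (rule circ_diag[OF h])
  have row: "(\<Sum>k<h. cnj (circ h b i k) * circ h b' i k) = of_real ?B" for i
  proof -
    have "(\<Sum>k<h. cnj (circ h b i k) * circ h b' i k) = (\<Sum>k<h. circ h b' i k * circ h b k i)"
      by (simp add: cnj_circ mult.commute)
    also have "\<dots> = of_real ((\<Sum>k<h. b' k * b k) / real h)"
      unfolding circ_mult by (rule circ_diag[OF h])
    finally show ?thesis by (simp add: mult.commute)
  qed
  have delta: "(\<Sum>k<r. cnj (if i = k then 1 else 0) * (if i = k then 1 else 0)) = (1 :: complex)"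
    if "i < r" for i
  proof -
    have "(\<Sum>k<r. cnj (if i = k then 1 else 0) * (if i = k then 1 else 0)) = (\<Sum>k<r. if i = k then 1 else 0 :: complex)"
      by (intro sum.cong) auto
    then show ?thesis using that by simp
  qed
  have "(\<Sum>i<2 * h + r. \<Sum>k<2 * h + r. cnj (refl_mat h a b i k) * refl_mat h a' b' i k)
      = (\<Sum>i<h. \<Sum>k<h. of_real (a k * a' k) * (cnj (circ h b i k) * circ h b' i k))
      + (\<Sum>i<h. \<Sum>k<h. of_real (a i * a' i) * (cnj (circ h b i k) * circ h b' i k))
      + (\<Sum>i<r. \<Sum>k<r. if k = i then 1 else 0)"
    unfolding sum_lessThan_blocks
    by (intro arg_cong2[where f = "(+)"] sum.cong refl) (auto simp: refl_mat_def delta intro!: sum.cong)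
  also have "(\<Sum>i<h. \<Sum>k<h. of_real (a k * a' k) * (cnj (circ h b i k) * circ h b' i k))
      = (\<Sum>k<h. of_real (a k * a' k) * (\<Sum>i<h. cnj (circ h b i k) * circ h b' i k))"
    unfolding sum_distrib_left by (rule sum.swap)
  also have "(\<Sum>i<h. \<Sum>k<h. of_real (a i * a' i) * (cnj (circ h b i k) * circ h b' i k))
      = (\<Sum>i<h. of_real (a i * a' i) * (\<Sum>k<h. cnj (circ h b i k) * circ h b' i k))"
    by (simp only: sum_distrib_left)
  finally show ?thesis
    unfolding row col sum_distrib_right[symmetric] by (simp add: algebra_simps)
qed

section \<open>The hard instances\<close>

definition max_ent :: "nat \<Rightarrow> nat \<times> nat \<Rightarrow> complex" where
  "max_ent d = (\<lambda>(i, j). if i = j then of_real (1 / sqrt (real d)) else 0)"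

lemma maximally_entangled_max_ent:
  assumes "d > 0"
  shows "maximally_entangled d (max_ent d)"
proof -
  have "(\<Sum>i<d. \<Sum>j<d. (cmod (max_ent d (i, j)))\<^sup>2) = (\<Sum>i<d. \<Sum>j<d. if j = i then 1 / real d else 0)"
    using assms by (intro sum.cong refl) (auto simp: max_ent_def norm_divide power_divide)
  also have "\<dots> = 1"
    using assms by simp
  finally have 1: "unit_state d (max_ent d)"
    by (simp add: unit_state_def sum_box)
  have "partial_trace_B d (max_ent d) i k = (if i = k then 1 / of_nat d else 0)" if "i < d" for i k
  proof -
    have "partial_trace_B d (max_ent d) i k = (\<Sum>j<d. if j = i then (if i = k then 1 / of_nat d else 0) else 0)"
      unfolding partial_trace_B_def using assms
      by (intro sum.cong refl) (auto simp: max_ent_def simp flip: of_real_mult)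
    then show ?thesis using that by simp
  qed
  with 1 show ?thesis by (simp add: maximally_entangled_def)
qed

text \<open>The expectation of a local operator is its trace against the reduced state
  \<open>I/d\<close>.\<close>

lemma cinner_loc_op_maximally_entangled:
  assumes "maximally_entangled d \<phi>"
  shows "cinner (box d) \<phi> (loc_op d Z \<phi>) = (\<Sum>i<d. Z i i) / of_nat d"
proof -
  have "cinner (box d) \<phi> (loc_op d Z \<phi>) = (\<Sum>i<d. \<Sum>j<d. \<Sum>k<d. Z i k * (\<phi> (k, j) * cnj (\<phi> (i, j))))"
    unfolding cinner_def sum_box
    by (intro sum.cong refl) (simp add: mat_vec_loc sum_distrib_left mult_ac)
  also have "\<dots> = (\<Sum>i<d. \<Sum>k<d. \<Sum>j<d. Z i k * (\<phi> (k, j) * cnj (\<phi> (i, j))))"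
    by (intro sum.cong refl sum.swap)
  also have "\<dots> = (\<Sum>i<d. \<Sum>k<d. Z i k * partial_trace_B d \<phi> k i)"
    by (simp add: partial_trace_B_def sum_distrib_left)
  also have "\<dots> = (\<Sum>i<d. \<Sum>k<d. if k = i then Z i i / of_nat d else 0)"
    using assms by (intro sum.cong refl) (auto simp: maximally_entangled_def)
  finally show ?thesis by (simp add: sum_divide_distrib)
qed

lemma cinner_maximally_entangled_self:
  "maximally_entangled d \<phi> \<Longrightarrow> cinner (box d) \<phi> \<phi> = 1"
  by (simp add: maximally_entangled_def unit_state_iff cinner_self)

text \<open>Applying an operator to the canonical state lists its entries, scaled by
  \<open>1 / sqrt d\<close>; overlaps become normalised Hilbert-Schmidt products.\<close>

lemma cinner_loc_op_max_ent:
  assumes "d > 0"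
  shows "cinner (box d) (loc_op d Y (max_ent d)) (loc_op d Z (max_ent d))
    = (\<Sum>i<d. \<Sum>k<d. cnj (Y i k) * Z i k) / of_nat d"
proof -
  have op: "loc_op d X (max_ent d) (i, j) = X i j / of_real (sqrt (real d))" if "j < d" for X i j
  proof -
    have "loc_op d X (max_ent d) (i, j) = (\<Sum>k<d. if k = j then X i j / of_real (sqrt (real d)) else 0)"
      unfolding mat_vec_loc[OF that] by (intro sum.cong refl) (auto simp: max_ent_def)
    then show ?thesis using that by simp
  qed
  show ?thesis
    unfolding cinner_def sum_box sum_divide_distrib using assms
    by (intro sum.cong refl) (simp add: op flip: of_real_mult)
qed

section \<open>Tilted states \<open>(1 + t Z) \<omega>\<close>\<close>

definition tilt :: "nat \<Rightarrow> (nat \<Rightarrow> nat \<Rightarrow> complex) \<Rightarrow> real \<Rightarrow> (nat \<times> nat \<Rightarrow> complex) \<Rightarrow> nat \<times> nat \<Rightarrow> complex" where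
  "tilt d Z t \<phi> = (\<lambda>p. \<phi> p + of_real t * loc_op d Z \<phi> p)"

lemma tilt_tilt:
  assumes "herm_invol d Z" "p \<in> box d"
  shows "tilt d Z t (tilt d Z t \<phi>) p = of_real (1 + t\<^sup>2) * \<phi> p + of_real (2 * t) * loc_op d Z \<phi> p"
  using assms by (simp add: tilt_def mat_vec_add mat_vec_scale loc_op_involution power2_eq_square algebra_simps)

lemma cinner_loc_op_twice:
  "herm_invol d Z \<Longrightarrow> cinner (box d) \<phi> (loc_op d Z (loc_op d Z \<psi>)) = cinner (box d) \<phi> \<psi>"
  by (intro cinner_cong refl loc_op_involution)

lemma cinner_tilt_ME:
  assumes Z: "herm_invol d Z" and tr: "(\<Sum>i<d. Z i i) = of_real (\<rho> * real d)"
    and d: "d > 0" and \<phi>: "maximally_entangled d \<phi>"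
  shows "cinner (box d) (tilt d Z t \<phi>) (tilt d Z t \<phi>) = of_real (1 + t\<^sup>2 + 2 * t * \<rho>)"
  using d cinner_loc_op_maximally_entangled[OF \<phi>, of Z]
  by (simp add: tilt_def cinner_add_left cinner_add_right cinner_scale_left cinner_scale_right
      cinner_loc_op_left[OF Z] cinner_loc_op_twice[OF Z] cinner_maximally_entangled_self[OF \<phi>] tr
      power2_eq_square algebra_simps)

text \<open>\<open>1 + t Z = (1 - t) + (t/2) (1 + Z)\<^sup>2\<close> is positive, so by Cauchy--Schwarz its
  overlap with a unitary is at most its trace.\<close>

lemma cmod_cinner_tilt_ME_le:
  assumes Z: "herm_invol d Z" and tr: "(\<Sum>i<d. Z i i) = of_real (\<rho> * real d)"
    and d: "d > 0" and \<omega>: "maximally_entangled d \<omega>" and \<phi>: "maximally_entangled d \<phi>"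
    and t: "0 \<le> t" "t \<le> 1"
  shows "cmod (cinner (box d) (tilt d Z t \<omega>) \<phi>) \<le> 1 + t * \<rho>"
proof -
  have sq: "sqnorm (box d) (tilt d Z 1 \<xi>) = 2 + 2 * \<rho>" if "maximally_entangled d \<xi>" for \<xi>
    using cinner_tilt_ME[OF Z tr d that, of 1] by (simp add: cinner_self del: of_real_add)
  have "2 + 2 * \<rho> \<ge> 0"
    using sq[OF \<phi>] sqnorm_nonneg[of "box d"] by metis
  then have b1: "cmod (cinner (box d) (tilt d Z 1 \<omega>) (tilt d Z 1 \<phi>)) \<le> 2 + 2 * \<rho>"
    using cmod_cinner_le[of "box d" "tilt d Z 1 \<omega>" "tilt d Z 1 \<phi>"] sq[OF \<omega>] sq[OF \<phi>] by simp
  have b2: "cmod (cinner (box d) \<omega> \<phi>) \<le> 1"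
    using cmod_cinner_le[of "box d" \<omega> \<phi>] \<omega> \<phi> by (simp add: maximally_entangled_def unit_state_iff)
  have "cinner (box d) (tilt d Z t \<omega>) \<phi>
      = of_real (1 - t) * cinner (box d) \<omega> \<phi> + of_real (t / 2) * cinner (box d) (tilt d Z 1 \<omega>) (tilt d Z 1 \<phi>)"
    by (simp add: tilt_def cinner_add_left cinner_add_right cinner_scale_left
        cinner_loc_op_left[OF Z] cinner_loc_op_twice[OF Z] algebra_simps)
  also have "cmod \<dots> \<le> (1 - t) * cmod (cinner (box d) \<omega> \<phi>)
      + (t / 2) * cmod (cinner (box d) (tilt d Z 1 \<omega>) (tilt d Z 1 \<phi>))"
    using t by (intro norm_triangle_le) (simp add: norm_mult del: of_real_diff of_real_divide)
  also have "\<dots> \<le> (1 - t) * 1 + (t / 2) * (2 + 2 * \<rho>)"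
    using t b1 b2 by (intro add_mono mult_left_mono) auto
  finally show ?thesis by (simp add: algebra_simps)
qed

text \<open>The overlap with any maximally entangled state is at most
  \<open>(1 + t * \<rho>) / n\<close>, and \<open>n\<^sup>2 - (1 + t * \<rho>)\<^sup>2 = t\<^sup>2 *
  (1 - \<rho>\<^sup>2)\<close>. The last hypothesis is exactly the resulting condition on the trace
  distance.\<close>

lemma far_from_ME_tilt:
  assumes Z: "herm_invol d Z" and tr: "(\<Sum>i<d. Z i i) = of_real (\<rho> * real d)"
    and d: "d > 0" and \<omega>: "maximally_entangled d \<omega>"
    and t: "0 \<le> t" "t \<le> 1" and n: "n\<^sup>2 = 1 + t\<^sup>2 + 2 * t * \<rho>" "n > 0"
    and \<epsilon>: "\<epsilon>\<^sup>2 * n\<^sup>2 \<le> t\<^sup>2 * (1 - \<rho>\<^sup>2)"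
  shows "far_from_ME d \<epsilon> (\<lambda>p. of_real (1 / n) * tilt d Z t \<omega> p)"
  unfolding far_from_ME_def
proof (intro conjI allI impI)
  have "sqnorm (box d) (tilt d Z t \<omega>) = n\<^sup>2"
    using cinner_tilt_ME[OF Z tr d \<omega>, of t] unfolding cinner_self n(1) by (metis of_real_eq_iff)
  then have "sqnorm (box d) (\<lambda>p. of_real (1 / n) * tilt d Z t \<omega> p) = (1 / n)\<^sup>2 * n\<^sup>2"
    by (simp add: sqnorm_def norm_mult norm_divide power_mult_distrib power_divide flip: sum_divide_distrib)
  then show "unit_state d (\<lambda>p. of_real (1 / n) * tilt d Z t \<omega> p)"
    using n(2) by (simp add: unit_state_iff power_divide)
next
  fix \<phi> assume \<phi>: "maximally_entangled d \<phi>"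
  define c where "c = cmod (cinner (box d) (\<lambda>p. of_real (1 / n) * tilt d Z t \<omega> p) \<phi>)"
  have "c * n = cmod (cinner (box d) (tilt d Z t \<omega>) \<phi>)"
    using n(2) unfolding c_def cinner_scale_left by (simp add: norm_divide norm_mult)
  also have "\<dots> \<le> 1 + t * \<rho>"
    by (rule cmod_cinner_tilt_ME_le[OF Z tr d \<omega> \<phi> t])
  finally have "(c * n)\<^sup>2 \<le> (1 + t * \<rho>)\<^sup>2"
    using n(2) by (intro power_mono) (auto simp: c_def)
  also have "\<dots> = n\<^sup>2 - t\<^sup>2 * (1 - \<rho>\<^sup>2)"
    unfolding n(1) by (simp add: power2_eq_square algebra_simps)
  finally have "\<epsilon>\<^sup>2 * n\<^sup>2 \<le> (1 - c\<^sup>2) * n\<^sup>2"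
    using \<epsilon> by (simp add: power_mult_distrib left_diff_distrib)
  then have "\<epsilon>\<^sup>2 \<le> 1 - c\<^sup>2"
    using n(2) by simp
  then show "\<epsilon> \<le> pure_trace_dist d (\<lambda>p. of_real (1 / n) * tilt d Z t \<omega> p) \<phi>"
    unfolding pure_trace_dist_eq c_def by (rule real_le_rsqrt)
qed

text \<open>Moving \<open>1 + t Z\<close> into one slot leaves the fixed vector
  \<open>\<omega>\<close> in the other. The acceptance probability of \<open>\<psi>\<close> becomes
  linear in the tensor power of \<open>\<phi>\<close>, so that averaging over \<open>Z\<close> can
  be done on vectors.\<close>

lemma tform_tilt:
  fixes c t :: real and \<omega> :: "nat \<times> nat \<Rightarrow> complex"
  assumes T: "loc_invariant d N T" and Z: "herm_invol d Z"
  defines "\<psi> \<equiv> \<lambda>p. of_real c * tilt d Z t \<omega> p"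
    and "\<phi> \<equiv> \<lambda>p. of_real (c\<^sup>2) * tilt d Z t (tilt d Z t \<omega>) p"
  shows "tform d N T \<omega> \<phi> = tform d N T \<psi> \<psi>" "tform d N T \<phi> \<omega> = tform d N T \<psi> \<psi>"
proof -
  have adj: "tform d N T (tilt d Z t \<xi>) \<zeta> = tform d N T \<xi> (tilt d Z t \<zeta>)" for \<xi> \<zeta>
    using tform_adjoint[OF T Z, of \<xi> "of_real t" \<zeta>] by (simp add: tilt_def)
  have \<psi>: "tform d N T \<psi> \<psi> = of_real ((c\<^sup>2) ^ N) * tform d N T (tilt d Z t \<omega>) (tilt d Z t \<omega>)"
    unfolding \<psi>_def tform_scale by (simp add: power2_eq_square)
  have "tform d N T \<omega> \<phi> = of_real ((c\<^sup>2) ^ N) * tform d N T \<omega> (tilt d Z t (tilt d Z t \<omega>))"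
    using tform_scale[where a = 1 and \<phi> = \<omega> and b = "of_real (c\<^sup>2)"] by (simp add: \<phi>_def)
  then show "tform d N T \<omega> \<phi> = tform d N T \<psi> \<psi>"
    unfolding \<psi> adj .
  have "tform d N T \<phi> \<omega> = of_real ((c\<^sup>2) ^ N) * tform d N T (tilt d Z t (tilt d Z t \<omega>)) \<omega>"
    using tform_scale[where b = 1 and \<psi> = \<omega> and a = "of_real (c\<^sup>2)"] by (simp add: \<phi>_def)
  then show "tform d N T \<phi> \<omega> = tform d N T \<psi> \<psi>"
    unfolding \<psi> by (simp only: adj)
qed

text \<open>With fewer copies, the mean pairwise overlap of the ensemble is at most
  \<open>exp (3/16)\<close>, below the 13/9 that any successful tester forces. The constant 128 is
  what makes \<open>\<nu> \<le> 1/8\<close>.\<close>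

lemma ME_tester_copies:
  assumes tester: "is_ME_tester d \<epsilon> N T0" and d: "d \<ge> 2" and \<epsilon>: "0 < \<epsilon>" "\<epsilon> \<le> 1/8"
  shows "real d / (128 * \<epsilon>\<^sup>2) \<le> real N"
proof (rule ccontr)
  assume "\<not> real d / (128 * \<epsilon>\<^sup>2) \<le> real N"
  then have N: "128 * \<epsilon>\<^sup>2 * real N \<le> real d"
    using \<epsilon>(1) by (simp add: field_simps)
  obtain T where T: "is_ME_tester d \<epsilon> N T" and inv: "loc_invariant d N T"
    using ME_tester_invariant[OF tester] unfolding loc_invariant_def by metis
  define h r where "h = d div 2" and "r = d mod 2"
  have h: "h > 0" and dhr: "d = 2 * h + r" and r: "r \<le> 1" and d0: "d > 0"
    using d by (auto simp: h_def r_def)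
  define \<rho> where "\<rho> = real r / real d"
  have \<rho>: "0 \<le> \<rho>" "\<rho> \<le> 1/3"
  proof -
    \<comment> \<open>If \<open>r = 1\<close> then \<open>d\<close> is odd and at least 3.\<close>
    have "3 * r \<le> d" using dhr h r by (cases r) auto
    then show "\<rho> \<le> 1/3" using d0 by (simp add: \<rho>_def field_simps flip: of_nat_mult)
  qed (simp add: \<rho>_def)
  have \<rho>2: "\<rho>\<^sup>2 \<le> 1/9"
    using power_mono[OF \<rho>(2,1), of 2] by (simp add: power2_eq_square)
  \<comment> \<open>The factor 2 pays for the normalisation \<open>n\<^sup>2 \<le> 2\<close> and for
    the loss \<open>\<rho>\<^sup>2 \<le> 1/9\<close> in the distance estimate.\<close>
  define t where "t = 2 * \<epsilon>"
  have t: "0 \<le> t" "t \<le> 1" "t \<le> 1/4" using \<epsilon> by (simp_all add: t_def)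
  have t2: "t\<^sup>2 \<le> 1/16"
    using power_mono[OF t(3,1), of 2] by (simp add: power2_eq_square)
  have t\<rho>: "0 \<le> t * \<rho>" "t * \<rho> \<le> 1/12"
    using t \<rho> mult_mono[OF t(3) \<rho>(2)] by auto
  define n where "n = sqrt (1 + t\<^sup>2 + 2 * t * \<rho>)"
  have "1 \<le> 1 + t\<^sup>2 + 2 * t * \<rho>" "1 + t\<^sup>2 + 2 * t * \<rho> \<le> 2"
    using t2 t\<rho> zero_le_power2[of t] by (simp_all add: mult.assoc del: zero_le_power2)
  then have n: "n\<^sup>2 = 1 + t\<^sup>2 + 2 * t * \<rho>" "n > 0" "1 \<le> n\<^sup>2" "n\<^sup>2 \<le> 2"
    by (simp_all add: n_def)
  define c where "c = 1 / n"
  have c: "c\<^sup>2 * n\<^sup>2 = 1" "0 < c\<^sup>2" "c\<^sup>2 \<le> 1"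
    using n by (simp_all add: c_def power_divide)
  let ?\<omega> = "max_ent d"
  let ?Z = "\<lambda>e. refl_mat h (fst e) (snd e)"
  define E where "E = signs h \<times> signs h"
  have card_E: "real (card E) = 4 ^ h"
    by (simp add: E_def card_cartesian_product flip: power_mult_distrib)
  define \<phi> where "\<phi> e = (\<lambda>p. of_real (c\<^sup>2) * tilt d (?Z e) t (tilt d (?Z e) t ?\<omega>) p)" for e
  \<comment> \<open>\<open>K e e'\<close> is the normalised trace of the product of two involutions.
    Below, \<open>\<mu>\<close> is its coefficient in the overlap of two instances, and
    \<open>\<nu>\<close> is that coefficient accumulated over \<open>N\<close> copies, per
    dimension.\<close>
  define K where "K e e' = (real r + 2 * (\<Sum>k<h. fst e k * fst e' k) * (\<Sum>k<h. snd e k * snd e' k) / real h) / real d"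
    for e e' :: "(nat \<Rightarrow> real) \<times> (nat \<Rightarrow> real)"
  define \<mu> where "\<mu> = 4 * t\<^sup>2 * (c\<^sup>2)\<^sup>2"
  define \<nu> where "\<nu> = real N * \<mu> / real d"
  have ME: "maximally_entangled d ?\<omega>"
    using d0 by (rule maximally_entangled_max_ent)
  have Z: "herm_invol d (?Z e)" if "e \<in> E" for e
    using that unfolding dhr E_def by (auto intro: herm_invol_refl_mat)
  have tr: "(\<Sum>i<d. ?Z e i i) = of_real (\<rho> * real d)" for e
    using trace_refl_mat[of h "fst e" "snd e" r] d0 by (simp add: \<rho>_def flip: dhr)
  have \<mu>: "0 \<le> \<mu>" "\<mu> \<le> 16 * \<epsilon>\<^sup>2" "\<mu> \<le> 1/4"
  proof -
    have "(c\<^sup>2)\<^sup>2 \<le> 1"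
      using power_le_one[of "c\<^sup>2" 2] c by simp
    then have "\<mu> \<le> 4 * t\<^sup>2"
      unfolding \<mu>_def using mult_left_mono[of "(c\<^sup>2)\<^sup>2" 1 "4 * t\<^sup>2"] by simp
    then show "\<mu> \<le> 16 * \<epsilon>\<^sup>2" "\<mu> \<le> 1/4"
      using t2 by (simp_all add: t_def power2_eq_square)
  qed (simp add: \<mu>_def)
  have \<nu>: "0 \<le> \<nu>" "\<nu> \<le> 1/8"
  proof -
    show "0 \<le> \<nu>" using \<mu> by (simp add: \<nu>_def)
    have "8 * (real N * \<mu>) \<le> 8 * (real N * (16 * \<epsilon>\<^sup>2))"
      using \<mu>(2) by (intro mult_left_mono) auto
    also have "\<dots> \<le> real d"
      using N by (simp add: algebra_simps)
    finally show "\<nu> \<le> 1/8"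
      using d0 by (simp add: \<nu>_def field_simps)
  qed
  have \<phi>_eq: "\<phi> e p = of_real (c\<^sup>2 * (1 + t\<^sup>2)) * ?\<omega> p + of_real (c\<^sup>2 * (2 * t)) * loc_op d (?Z e) ?\<omega> p"
    if "e \<in> E" "p \<in> box d" for e p
    unfolding \<phi>_def tilt_tilt[OF Z[OF that(1)] that(2)] by (simp add: algebra_simps)
  have \<omega>L: "cinner (box d) ?\<omega> (loc_op d (?Z e) ?\<omega>) = of_real \<rho>" for e
    unfolding cinner_loc_op_maximally_entangled[OF ME] tr using d0 by simp
  then have L\<omega>: "cinner (box d) (loc_op d (?Z e) ?\<omega>) ?\<omega> = of_real \<rho>" for e
    by (subst cnj_cinner[symmetric]) simp
  have LL: "cinner (box d) (loc_op d (?Z e) ?\<omega>) (loc_op d (?Z e') ?\<omega>) = of_real (K e e')" for e e'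
    using overlap_refl_mat[OF h, where r = r and a = "fst e" and b = "snd e" and a' = "fst e'" and b' = "snd e'"]
    unfolding cinner_loc_op_max_ent[OF d0] dhr[symmetric] K_def by simp
  have overlap: "cinner (box d) (\<phi> e) (\<phi> e') = of_real (1 + \<mu> * (K e e' - \<rho>\<^sup>2))"
    if e: "e \<in> E" "e' \<in> E" for e e'
  proof -
    have "cinner (box d) (\<phi> e) (\<phi> e')
       = cinner (box d) (\<lambda>p. of_real (c\<^sup>2 * (1 + t\<^sup>2)) * ?\<omega> p + of_real (c\<^sup>2 * (2 * t)) * loc_op d (?Z e) ?\<omega> p)
           (\<lambda>p. of_real (c\<^sup>2 * (1 + t\<^sup>2)) * ?\<omega> p + of_real (c\<^sup>2 * (2 * t)) * loc_op d (?Z e') ?\<omega> p)"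
      using e by (intro cinner_cong \<phi>_eq)
    also have "\<dots> = of_real ((c\<^sup>2)\<^sup>2 * ((1 + t\<^sup>2)\<^sup>2 + 4 * t * (1 + t\<^sup>2) * \<rho> + 4 * t\<^sup>2 * K e e'))"
      unfolding cinner_add_left cinner_add_right cinner_scale_left cinner_scale_right \<omega>L L\<omega> LL
        cinner_maximally_entangled_self[OF ME]
      by (simp add: power2_eq_square algebra_simps)
    \<comment> \<open>Completing the square: the bracket is the square of \<open>n\<^sup>2\<close>
      plus \<open>4 * t\<^sup>2 * (K e e' - \<rho>\<^sup>2)\<close>.\<close>
    also have "(c\<^sup>2)\<^sup>2 * ((1 + t\<^sup>2)\<^sup>2 + 4 * t * (1 + t\<^sup>2) * \<rho> + 4 * t\<^sup>2 * K e e')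
        = (c\<^sup>2 * n\<^sup>2)\<^sup>2 + \<mu> * (K e e' - \<rho>\<^sup>2)"
      unfolding n(1) \<mu>_def by (simp add: power2_eq_square algebra_simps)
    finally show ?thesis by (simp add: c(1))
  qed
  \<comment> \<open>Makes the base \<open>1 + \<mu> * (K e e' - \<rho>\<^sup>2)\<close> nonnegative,
    so that \<open>1 + x \<le> exp x\<close> may be raised to the power \<open>N\<close>.\<close>
  have K_ge: "- 1 \<le> K e e'" if e: "e \<in> E" "e' \<in> E" for e e'
  proof -
    have "sqnorm (box d) (loc_op d (?Z e) ?\<omega>) = 1" if "e \<in> E" for e
      using Z[OF that] ME by (simp add: sqnorm_unitary unitary_on_loc herm_invol_unitary
          maximally_entangled_def unit_state_iff)
    then have "cmod (of_real (K e e')) \<le> 1"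
      unfolding LL[symmetric]
      using e cmod_cinner_le[of "box d" "loc_op d (?Z e) ?\<omega>" "loc_op d (?Z e') ?\<omega>"] by simp
    then show ?thesis by simp
  qed
  have term_le: "Re (cinner (box d) (\<phi> e) (\<phi> e') ^ N)
      \<le> exp \<nu> * exp (2 * \<nu> * (\<Sum>k<h. fst e k * fst e' k) * (\<Sum>k<h. snd e k * snd e' k) / real h)"
    if e: "e \<in> E" "e' \<in> E" for e e'
  proof -
    let ?y = "1 + \<mu> * (K e e' - \<rho>\<^sup>2)"
    have "- (1/2) \<le> \<mu> * (- 2)" using \<mu> by simp
    also have "\<dots> \<le> \<mu> * (K e e' - \<rho>\<^sup>2)"
      using K_ge[OF e] \<rho>2 \<mu> by (intro mult_left_mono) auto
    finally have y: "0 \<le> ?y" by simp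
    have "Re (cinner (box d) (\<phi> e) (\<phi> e') ^ N) = ?y ^ N"
      unfolding overlap[OF e] of_real_power[symmetric] by (rule Re_complex_of_real)
    also have "\<dots> \<le> exp (\<mu> * (K e e' - \<rho>\<^sup>2)) ^ N"
      using y by (intro power_mono exp_ge_add_one_self) auto
    also have "\<dots> = exp (real N * (\<mu> * (K e e' - \<rho>\<^sup>2)))"
      by (rule exp_of_nat_mult[symmetric])
    also have "\<dots> \<le> exp (\<nu> * (real d * K e e'))"
    proof -
      have "real N * (\<mu> * (K e e' - \<rho>\<^sup>2)) \<le> real N * (\<mu> * K e e')"
        using \<mu> by (intro mult_left_mono) auto
      also have "\<dots> = \<nu> * (real d * K e e')"
        using d0 by (simp add: \<nu>_def)
      finally show ?thesis by simp
    qed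
    also have "\<dots> = exp (\<nu> * real r) * exp (2 * \<nu> * (\<Sum>k<h. fst e k * fst e' k) * (\<Sum>k<h. snd e k * snd e' k) / real h)"
    proof -
      have "real d * K e e' = real r + 2 * (\<Sum>k<h. fst e k * fst e' k) * (\<Sum>k<h. snd e k * snd e' k) / real h"
        using d0 by (simp add: K_def)
      then show ?thesis
        by (simp add: exp_add[symmetric] algebra_simps)
    qed
    also have "\<dots> \<le> exp \<nu> * exp (2 * \<nu> * (\<Sum>k<h. fst e k * fst e' k) * (\<Sum>k<h. snd e k * snd e' k) / real h)"
    proof (intro mult_right_mono)
      show "exp (\<nu> * real r) \<le> exp \<nu>"
        using \<nu> r mult_left_mono[of "real r" 1 \<nu>] by simp
    qed simp
    finally show ?thesis .
  qed
  have "13/9 * (4 ^ h)\<^sup>2 \<le> (\<Sum>e\<in>E. \<Sum>e'\<in>E. Re (cinner (box d) (\<phi> e) (\<phi> e') ^ N))"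
    unfolding card_E[symmetric]
  proof (rule average_overlap_ge[where T = T and \<omega> = ?\<omega>])
    show "valid_measurement d N T" "2/3 \<le> Re (tform d N T ?\<omega> ?\<omega>)"
      using T ME by (auto simp: is_ME_tester_def accept_prob_eq)
    show "finite E" by (simp add: E_def)
    show "E \<noteq> {}" using card_E by auto
    show "cinner (box d) ?\<omega> ?\<omega> = 1"
      by (rule cinner_maximally_entangled_self[OF ME])
  next
    fix e assume e: "e \<in> E"
    have "cinner (box d) ?\<omega> (\<phi> e)
       = cinner (box d) ?\<omega> (\<lambda>p. of_real (c\<^sup>2 * (1 + t\<^sup>2)) * ?\<omega> p + of_real (c\<^sup>2 * (2 * t)) * loc_op d (?Z e) ?\<omega> p)"
      using e by (intro cinner_cong \<phi>_eq refl)
    also have "\<dots> = of_real (c\<^sup>2 * n\<^sup>2)"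
      unfolding cinner_add_right cinner_scale_right \<omega>L cinner_maximally_entangled_self[OF ME] n(1)
      by (simp add: algebra_simps)
    finally show "cinner (box d) ?\<omega> (\<phi> e) = 1" by (simp only: c(1) of_real_1)
    have "\<epsilon>\<^sup>2 * n\<^sup>2 \<le> \<epsilon>\<^sup>2 * 2"
      using n by (intro mult_left_mono) auto
    also have "\<dots> \<le> \<epsilon>\<^sup>2 * (4 * (1 - \<rho>\<^sup>2))"
      using \<rho>2 by (intro mult_left_mono) auto
    also have "\<dots> = t\<^sup>2 * (1 - \<rho>\<^sup>2)"
      by (simp add: t_def power2_eq_square)
    finally have "far_from_ME d \<epsilon> (\<lambda>p. of_real c * tilt d (?Z e) t ?\<omega> p)"
      unfolding c_def by (intro far_from_ME_tilt[OF Z[OF e] tr d0 ME t(1,2) n(1,2)])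
    then show "Re (tform d N T ?\<omega> (\<phi> e)) + Re (tform d N T (\<phi> e) ?\<omega>) \<le> 2/3"
      unfolding \<phi>_def tform_tilt[OF inv Z[OF e]]
      using T by (fastforce simp: is_ME_tester_def accept_prob_eq)
  qed
  also have "\<dots> \<le> (\<Sum>e\<in>E. \<Sum>e'\<in>E. exp \<nu>
      * exp (2 * \<nu> * (\<Sum>k<h. fst e' k * fst e k) * (\<Sum>k<h. snd e' k * snd e k) / real h))"
    using term_le by (intro sum_mono) (simp add: mult.commute)
  \<comment> \<open>For each fixed \<open>e\<close> the inner sum over \<open>e'\<close> is already
    small, by the product bound with \<open>\<kappa> = 2 * \<nu>\<close>; no averaging over
    \<open>e\<close> is involved.\<close>
  also have "\<dots> \<le> (\<Sum>e\<in>E. exp \<nu> * (4 ^ h * exp ((2 * \<nu>)\<^sup>2)))"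
  proof (rule sum_mono)
    fix e assume "e \<in> E"
    then have sg: "fst e \<in> signs h" "snd e \<in> signs h" by (auto simp: E_def)
    have "2 * (2 * \<nu>)\<^sup>2 \<le> 1"
      using power_mono[OF \<nu>(2,1), of 2] by (simp add: power2_eq_square)
    then have "(\<Sum>a\<in>signs h. \<Sum>b\<in>signs h. exp (2 * \<nu> * (\<Sum>k<h. a k * fst e k) * (\<Sum>k<h. b k * snd e k) / real h))
        \<le> 4 ^ h * exp ((2 * \<nu>)\<^sup>2)"
      using h sg by (intro sum_exp_product_signs) (auto dest: signs_cases)
    then show "(\<Sum>e'\<in>E. exp \<nu> * exp (2 * \<nu> * (\<Sum>k<h. fst e' k * fst e k) * (\<Sum>k<h. snd e' k * snd e k) / real h))
        \<le> exp \<nu> * (4 ^ h * exp ((2 * \<nu>)\<^sup>2))"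
      unfolding sum_distrib_left[symmetric] E_def
      by (intro mult_left_mono) (simp_all add: sum.cartesian_product case_prod_unfold)
  qed
  also have "\<dots> = (4 ^ h)\<^sup>2 * exp (\<nu> + 4 * \<nu>\<^sup>2)"
    by (simp add: card_E exp_add power2_eq_square)
  finally have "13/9 \<le> exp (\<nu> + 4 * \<nu>\<^sup>2)"
    by simp
  also have "\<dots> \<le> exp (3/16)"
    using \<nu> power_mono[OF \<nu>(2,1), of 2] by (simp add: power2_eq_square)
  \<comment> \<open>The reciprocal of \<open>exp (- 3/16) \<ge> 13/16\<close>.\<close>
  also have "\<dots> \<le> 16/13"
    using exp_ge_add_one_self[of "- 3/16 :: real"] by (simp add: exp_minus field_simps)
  finally show False by simp
qed

theorem theorem4p10:
  shows "\<exists>c>0. \<exists>\<epsilon>0>0. \<forall>d\<ge>2. \<forall>\<epsilon>::real. 0 < \<epsilon> \<and> \<epsilon> \<le> \<epsilon>0 \<longrightarrow>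
           ereal (c * real d / \<epsilon>\<^sup>2) \<le> ereal_of_enat (sample_complexity_ME d \<epsilon>)"
proof (rule exI[of _ "1/128"], intro conjI, simp, rule exI[of _ "1/8"], intro conjI allI impI)
  fix d :: nat and \<epsilon> :: real
  assume d: "2 \<le> d" and \<epsilon>: "0 < \<epsilon> \<and> \<epsilon> \<le> 1/8"
  let ?S = "{enat N | N. \<exists>T. is_ME_tester d \<epsilon> N T}"
  show "ereal (1/128 * real d / \<epsilon>\<^sup>2) \<le> ereal_of_enat (sample_complexity_ME d \<epsilon>)"
  proof (cases "?S = {}")
    \<comment> \<open>Without any tester the infimum is infinite.\<close>
    case True
    then show ?thesis by (simp add: sample_complexity_ME_def top_enat_def)
  next
    case False
    \<comment> \<open>\<open>enat\<close> is well-ordered, so a nonempty set attains its infimum and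
      an actual tester realises the sample complexity.\<close>
    then have "Inf ?S \<in> ?S"
      by (metis (no_types, lifting) Inf_enat_def LeastI ex_in_conv)
    then obtain N T where N: "sample_complexity_ME d \<epsilon> = enat N" and T: "is_ME_tester d \<epsilon> N T"
      by (auto simp: sample_complexity_ME_def)
    show ?thesis
      using ME_tester_copies[OF T d] \<epsilon> by (simp add: N field_simps)
  qed
qed simp

end
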